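(* Let $d\in\mathbb{N}$ and let $\mathcal{H}$ be a weighted Besov space on $\mathbb{B}_d$ that satisfies the multiplier inclusion condition. Then $M^C(\mathcal{H})\subseteq M^R(\mathcal{H})$, and there is a $c>0$ such that $$\|\Phi^R\|_{\mathcal{H}}\le c\|\Phi^C\|_{\mathcal{H}}$$ for all $\Phi\in M^C(\mathcal{H})$.
   Context: $\mathbb{B}_d$ is the open unit ball of $\mathbb{C}^d$ and $V$ is Lebesgue measure on $\mathbb{B}_d$ normalized so that $V(\mathbb{B}_d)=1$. A non-negative integrable function $\omega$ on $\mathbb{B}_d$ is an admissible weight if $L^2_a(\omega)=L^2(\omega\,dV)\cap\operatorname{Hol}(\mathbb{B}_d)$ is closed in $L^2(\omega\,dV)$ and point evaluations $f\mapsto f(z)$ are bounded on $L^2_a(\omega)$ for each $z\in\mathbb{B}_d$. Let $R=\sum_{i=1}^dz_i\frac{\partial}{\partial z_i}$. For a positive integer $N$ and an admissible weight $\omega$ let $B^N_\omega=\{f\in\operatorname{Hol}(\mathbb{B}_d):R^Nf\in L^2_a(\omega)\}$ with norm $\|f\|^2_{B^N_\omega}=\|\omega\|_{L^1(V)}|f(0)|^2+\int_{\mathbb{B}_d}|R^Nf|^2\omega\,dV$, and let $B^0_\omega=L^2_a(\omega)$. A weighted Besov space is a Hilbert space $\mathcal{H}$ of analytic functions on $\mathbb{B}_d$ (with bounded point evaluations) such that $\mathcal{H}=B^N_\omega$ with equivalence of norms for some admissible weight $\omega$ and some integer $N\ge 0$. For a Hilbert function space $\mathcal{H}$ with multiplier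 algebra $\operatorname{Mult}(\mathcal{H})=\{\varphi:\varphi\mathcal{H}\subseteq\mathcal{H}\}$, a sequence $\Phi=\{\varphi_1,\varphi_2,\dots\}\subseteq\operatorname{Mult}(\mathcal{H})$ defines a column operator $\Phi^C:h\mapsto(\varphi_1h,\varphi_2h,\dots)^T$ and a row operator $\Phi^R:(h_1,h_2,\dots)^T\mapsto\sum_i\varphi_ih_i$. $M^C(\mathcal{H})$ is the set of those column operators that are bounded $\mathcal{H}\to\bigoplus_{n=1}^\infty\mathcal{H}$, and $M^R(\mathcal{H})$ the set of those row operators that are bounded $\bigoplus_{n=1}^\infty\mathcal{H}\to\mathcal{H}$; the operator norms are denoted $\|\Phi^C\|_{\mathcal{H}}$, $\|\Phi^R\|_{\mathcal{H}}$. Both sets are identified with sets of sequences $\Phi$. A weighted Besov space $\mathcal{H}$ satisfies the multiplier inclusion condition if there are an admissible weight $\omega$ on $\mathbb{B}_d$ and an integer $N\ge0$ with $\mathcal{H}=B^N_\omega$ (equivalent norms) and $M^C(B^N_\omega)\subseteq M^C(B^{N-1}_\omega)\subseteq\cdots\subseteq M^C(B^0_\omega)$ with continuous inclusions. *)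

theory Defs
  imports "HOL-Analysis.Analysis"
begin

section \<open>Operators between normed function spaces\<close>

text \<open>
  A normed space is given by an explicit carrier and a norm, since the spaces below all consist of
  functions of the same type. The values of \<open>vnorm\<close> off the carrier carry no meaning.
\<close>

record 'v normed_carrier =
  elems :: "'v set"
  vnorm :: "'v \<Rightarrow> real"

definition bounded_operator ::
  "'v normed_carrier \<Rightarrow> 'w normed_carrier \<Rightarrow> ('v \<Rightarrow> 'w) \<Rightarrow> bool" where
  "bounded_operator X Y T \<longleftrightarrow>
     (\<forall>x\<in>elems X. T x \<in> elems Y) \<and>
     (\<exists>C. \<forall>x\<in>elems X. vnorm Y (T x) \<le> C * vnorm X x)"

definition operator_norm ::
  "'v normed_carrier \<Rightarrow> 'w normed_carrier \<Rightarrow> ('v \<Rightarrow> 'w) \<Rightarrow> real" where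
  "operator_norm X Y T = (SUP x\<in>{x \<in> elems X. vnorm X x \<le> 1}. vnorm Y (T x))"

definition direct_sum :: "'v normed_carrier \<Rightarrow> (nat \<Rightarrow> 'v) normed_carrier" where
  "direct_sum X =
     \<lparr> elems = {h. (\<forall>n. h n \<in> elems X) \<and> summable (\<lambda>n. (vnorm X (h n))\<^sup>2)},
       vnorm = (\<lambda>h. sqrt (\<Sum>n. (vnorm X (h n))\<^sup>2)) \<rparr>"

definition equivalent_spaces :: "'v normed_carrier \<Rightarrow> 'v normed_carrier \<Rightarrow> bool" where
  "equivalent_spaces X Y \<longleftrightarrow>
     elems X = elems Y \<and>
     (\<exists>a>0. \<exists>b>0. \<forall>f\<in>elems X. a * vnorm X f \<le> vnorm Y f \<and> vnorm Y f \<le> b * vnorm X f)"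

definition inner_product_on ::
  "('a \<Rightarrow> complex) set \<Rightarrow> (('a \<Rightarrow> complex) \<Rightarrow> ('a \<Rightarrow> complex) \<Rightarrow> complex) \<Rightarrow> bool" where
  "inner_product_on F ip \<longleftrightarrow>
     (\<forall>f\<in>F. \<forall>g\<in>F. \<forall>h\<in>F. ip (\<lambda>z. f z + g z) h = ip f h + ip g h) \<and>
     (\<forall>f\<in>F. \<forall>g\<in>F. \<forall>c. ip (\<lambda>z. c * f z) g = c * ip f g) \<and>
     (\<forall>f\<in>F. \<forall>g\<in>F. ip g f = cnj (ip f g)) \<and>
     (\<forall>f\<in>F. f \<noteq> (\<lambda>z. 0) \<longrightarrow> 0 < Re (ip f f))"

definition hilbert_function_space ::
  "'a set \<Rightarrow> ('a \<Rightarrow> complex) normed_carrier \<Rightarrow> bool" where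
  "hilbert_function_space D X \<longleftrightarrow>
     (\<lambda>z. 0) \<in> elems X \<and>
     (\<forall>f\<in>elems X. \<forall>g\<in>elems X. (\<lambda>z. f z + g z) \<in> elems X) \<and>
     (\<forall>f\<in>elems X. \<forall>c. (\<lambda>z. c * f z) \<in> elems X) \<and>
     (\<exists>ip. inner_product_on (elems X) ip \<and>
           (\<forall>f\<in>elems X. vnorm X f = sqrt (Re (ip f f)))) \<and>
     (\<forall>f. (\<forall>n. f n \<in> elems X) \<and>
          (\<forall>e>0. \<exists>M::nat. \<forall>m\<ge>M. \<forall>n\<ge>M. vnorm X (\<lambda>z. f m z - f n z) < e)
          \<longrightarrow> (\<exists>g\<in>elems X. (\<lambda>n. vnorm X (\<lambda>z. f n z - g z)) \<longlonglongrightarrow> 0)) \<and>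
     (\<forall>z\<in>D. \<exists>C. \<forall>f\<in>elems X. cmod (f z) \<le> C * vnorm X f)"


section \<open>Multipliers, columns and rows\<close>

definition Mult :: "('a \<Rightarrow> complex) normed_carrier \<Rightarrow> ('a \<Rightarrow> complex) set" where
  "Mult X = {\<phi>. \<forall>h\<in>elems X. (\<lambda>z. \<phi> z * h z) \<in> elems X}"

definition column_op :: "(nat \<Rightarrow> 'a \<Rightarrow> complex) \<Rightarrow> ('a \<Rightarrow> complex) \<Rightarrow> nat \<Rightarrow> 'a \<Rightarrow> complex" where
  "column_op \<Phi> h = (\<lambda>n z. \<Phi> n z * h z)"

definition row_op :: "(nat \<Rightarrow> 'a \<Rightarrow> complex) \<Rightarrow> (nat \<Rightarrow> 'a \<Rightarrow> complex) \<Rightarrow> 'a \<Rightarrow> complex" where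
  "row_op \<Phi> h = (\<lambda>z. \<Sum>n. \<Phi> n z * h n z)"

definition MC :: "('a \<Rightarrow> complex) normed_carrier \<Rightarrow> (nat \<Rightarrow> 'a \<Rightarrow> complex) set" where
  "MC X = {\<Phi>. (\<forall>n. \<Phi> n \<in> Mult X) \<and> bounded_operator X (direct_sum X) (column_op \<Phi>)}"

text \<open>
  The series defining a row operator is required to converge in the norm of the space. Since point
  evaluations are bounded, its sum is then the pointwise sum \<open>row_op\<close>.
\<close>

definition MR :: "('a \<Rightarrow> complex) normed_carrier \<Rightarrow> (nat \<Rightarrow> 'a \<Rightarrow> complex) set" where
  "MR X = {\<Phi>. (\<forall>n. \<Phi> n \<in> Mult X) \<and> bounded_operator (direct_sum X) X (row_op \<Phi>) \<and>
     (\<forall>h\<in>elems (direct_sum X).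
        (\<lambda>m. vnorm X (\<lambda>z. (\<Sum>n<m. \<Phi> n z * h n z) - row_op \<Phi> h z)) \<longlonglongrightarrow> 0)}"

definition column_norm ::
  "('a \<Rightarrow> complex) normed_carrier \<Rightarrow> (nat \<Rightarrow> 'a \<Rightarrow> complex) \<Rightarrow> real" where
  "column_norm X \<Phi> = operator_norm X (direct_sum X) (column_op \<Phi>)"

definition row_norm ::
  "('a \<Rightarrow> complex) normed_carrier \<Rightarrow> (nat \<Rightarrow> 'a \<Rightarrow> complex) \<Rightarrow> real" where
  "row_norm X \<Phi> = operator_norm (direct_sum X) X (row_op \<Phi>)"


section \<open>Weighted Besov spaces on the unit ball\<close>

text \<open>
  The space \<open>complex ^ 'd\<close> carries the Euclidean norm. An analytic function on the ball is
  represented by its extension by zero, so that equality of analytic functions is equality of HOL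
  functions. Weights and multipliers may take arbitrary values off the ball; these values never
  matter, because the measure lives on the ball and the elements of the spaces vanish outside it.
\<close>

abbreviation Bd :: "(complex ^ 'd) set" where
  "Bd \<equiv> ball 0 1"

definition V :: "(complex ^ 'd) measure" where
  "V = uniform_measure (lebesgue_on Bd) Bd"

definition Hol :: "(complex ^ 'd \<Rightarrow> complex) set" where
  "Hol = {f. (\<forall>z\<in>Bd. \<exists>D. (f has_derivative D) (at z) \<and> (\<forall>c v. D (c *s v) = c * D v)) \<and>
             (\<forall>z. z \<notin> Bd \<longrightarrow> f z = 0)}"

definition partial_deriv :: "'d \<Rightarrow> (complex ^ 'd \<Rightarrow> complex) \<Rightarrow> complex ^ 'd \<Rightarrow> complex" where
  "partial_deriv i f z = deriv (\<lambda>t. f (z + axis i t)) 0"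

definition radial_deriv :: "(complex ^ 'd \<Rightarrow> complex) \<Rightarrow> complex ^ 'd \<Rightarrow> complex" where
  "radial_deriv f z = (if z \<in> Bd then \<Sum>i\<in>UNIV. z $ i * partial_deriv i f z else 0)"

definition L2 :: "(complex ^ 'd \<Rightarrow> real) \<Rightarrow> (complex ^ 'd \<Rightarrow> complex) set" where
  "L2 \<omega> = {f \<in> borel_measurable V. integrable V (\<lambda>z. (cmod (f z))\<^sup>2 * \<omega> z)}"

definition L2_norm :: "(complex ^ 'd \<Rightarrow> real) \<Rightarrow> (complex ^ 'd \<Rightarrow> complex) \<Rightarrow> real" where
  "L2_norm \<omega> f = sqrt (\<integral>z. (cmod (f z))\<^sup>2 * \<omega> z \<partial>V)"

definition L2a :: "(complex ^ 'd \<Rightarrow> real) \<Rightarrow> (complex ^ 'd \<Rightarrow> complex) set" where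
  "L2a \<omega> = L2 \<omega> \<inter> Hol"

text \<open>
  In the second-to-last conjunct, \<open>g\<close> represents an element of the Hilbert space of classes modulo
  equality almost everywhere with respect to \<open>\<omega> dV\<close>.
\<close>

definition admissible_weight :: "(complex ^ 'd \<Rightarrow> real) \<Rightarrow> bool" where
  "admissible_weight \<omega> \<longleftrightarrow>
     (\<forall>z\<in>Bd. 0 \<le> \<omega> z) \<and>
     integrable V \<omega> \<and>
     (\<forall>f. \<forall>g\<in>L2 \<omega>. (\<forall>n. f n \<in> L2a \<omega>) \<and> (\<lambda>n. L2_norm \<omega> (\<lambda>z. f n z - g z)) \<longlonglongrightarrow> 0
        \<longrightarrow> (\<exists>h\<in>L2a \<omega>. AE z in density V (\<lambda>z. ennreal (\<omega> z)). h z = g z)) \<and>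
     (\<forall>z\<in>Bd. \<exists>C. \<forall>f\<in>L2a \<omega>. cmod (f z) \<le> C * L2_norm \<omega> f)"

definition besov ::
  "nat \<Rightarrow> (complex ^ 'd \<Rightarrow> real) \<Rightarrow> (complex ^ 'd \<Rightarrow> complex) normed_carrier" where
  "besov N \<omega> =
     (if N = 0 then \<lparr> elems = L2a \<omega>, vnorm = L2_norm \<omega> \<rparr>
      else \<lparr> elems = {f \<in> Hol. (radial_deriv ^^ N) f \<in> L2a \<omega>},
             vnorm = (\<lambda>f. sqrt ((\<integral>z. \<bar>\<omega> z\<bar> \<partial>V) * (cmod (f 0))\<^sup>2 +
                                (\<integral>z. (cmod ((radial_deriv ^^ N) f z))\<^sup>2 * \<omega> z \<partial>V))) \<rparr>)"

definition weighted_besov_space :: "(complex ^ 'd \<Rightarrow> complex) normed_carrier \<Rightarrow> bool" where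
  "weighted_besov_space H \<longleftrightarrow>
     hilbert_function_space Bd H \<and> elems H \<subseteq> Hol \<and>
     (\<exists>\<omega> N. admissible_weight \<omega> \<and> equivalent_spaces H (besov N \<omega>))"

definition multiplier_inclusion_condition ::
  "(complex ^ 'd \<Rightarrow> complex) normed_carrier \<Rightarrow> bool" where
  "multiplier_inclusion_condition H \<longleftrightarrow>
     (\<exists>\<omega> N. admissible_weight \<omega> \<and> equivalent_spaces H (besov N \<omega>) \<and>
       (\<forall>k<N. MC (besov (Suc k) \<omega>) \<subseteq> MC (besov k \<omega>) \<and>
          (\<exists>c. \<forall>\<Phi>\<in>MC (besov (Suc k) \<omega>).
             column_norm (besov k \<omega>) \<Phi> \<le> c * column_norm (besov (Suc k) \<omega>) \<Phi>)))"

end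

theory Submission
  imports Defs "HOL-Complex_Analysis.Cauchy_Integral_Formula"
begin

text \<open>
  By Leibniz' rule, \<open>R\<^sup>N (\<Sum>\<^sub>n \<phi>\<^sub>n h\<^sub>n)\<close> is a combination of the sums
  \<open>\<Sum>\<^sub>n (R\<^sup>k \<phi>\<^sub>n) (R\<^sup>N\<^sup>-\<^sup>k h\<^sub>n)\<close>. By the pointwise Cauchy-Schwarz inequality the square of
  such a sum is at most \<open>\<Sum>\<^sub>m \<Sum>\<^sub>n \<bar>R\<^sup>k \<phi>\<^sub>n\<bar>\<^sup>2 \<bar>R\<^sup>N\<^sup>-\<^sup>k h\<^sub>m\<bar>\<^sup>2\<close>, in which only the column of
  the \<open>R\<^sup>k \<phi>\<^sub>n\<close> acts on each \<open>R\<^sup>N\<^sup>-\<^sup>k h\<^sub>m\<close>, a function in the space of order \<open>k\<close>. So it suffices that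
  the column \<open>(R\<^sup>k \<phi>\<^sub>n)\<^sub>n\<close> maps the space of order \<open>k\<close> boundedly into \<open>L\<^sup>2(\<omega>)\<close>. This follows by induction on
  \<open>k\<close> from the multiplier inclusion condition. Bounds for finite partial sums are enough, because the
  space is complete and point evaluations are bounded.
\<close>

section \<open>The radial derivative\<close>

text \<open>The obstacle is that a row operator sums over n inside the modulus and couples phi_n
  with h_n, whereas a column bound speaks of a single function. Cauchy-Schwarz breaks the coupling
  at the price of a double sum. The price is affordable because a column bound controls the whole
  sum over n at once, so that each h_m contributes only its own squared norm. The function R^(N-k)
  h_m is only known to lie in the space of order k, and there the column must act. This is why
  column bounds are required in every order from 0 to N, with constants independent of the column.
  For N > 0 the norm also contains the value at the origin. It is controlled by letting the column
  act on the constant function 1. Iterating R requires that R preserve holomorphy, which is given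
  here as complex differentiability at each point of the ball. Restriction to complex lines reduces
  this to Cauchy estimates in one variable.\<close>

lemma norm_vector_scalar_mult: "norm (c *s v) = cmod c * norm (v :: complex ^ 'd)"
  by (simp add: norm_vec_def vector_scalar_mult_def norm_mult L2_set_right_distrib)

lemma bounded_linear_vector_scalar_mult_left: "bounded_linear (\<lambda>t. t *s (v :: complex ^ 'd))"
proof (rule bounded_linear_intro)
  show "norm (t *s v) \<le> norm t * norm v" for t :: complex
    by (simp add: norm_vector_scalar_mult)
qed (auto simp: vec_eq_iff algebra_simps)

definition cderiv :: "(complex ^ 'd \<Rightarrow> complex) \<Rightarrow> complex ^ 'd \<Rightarrow> complex ^ 'd \<Rightarrow> complex" where
  "cderiv f z = frechet_derivative f (at z)"

text \<open>The space \<open>complex ^ 'd\<close> enters \<open>has_derivative\<close> as a real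
  normed space, so \<open>D\<close> is a priori only real linear. The homogeneity clause makes it
  complex linear.\<close>

definition holo_at :: "(complex ^ 'd \<Rightarrow> complex) \<Rightarrow> complex ^ 'd \<Rightarrow> bool" where
  "holo_at f z \<longleftrightarrow> (\<exists>D. (f has_derivative D) (at z) \<and> (\<forall>c v. D (c *s v) = c * D v))"

lemma Hol_iff: "f \<in> Hol \<longleftrightarrow> (\<forall>z\<in>Bd. holo_at f z) \<and> (\<forall>z. z \<notin> Bd \<longrightarrow> f z = 0)"
  by (simp add: Hol_def holo_at_def)

lemma holo_atI:
  "(f has_derivative D) (at z) \<Longrightarrow> (\<And>c v. D (c *s v) = c * D v) \<Longrightarrow> holo_at f z"
  by (auto simp: holo_at_def)

lemma cderiv_eqI: "(f has_derivative D) (at z) \<Longrightarrow> cderiv f z = D"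
  using frechet_derivative_at by (force simp: cderiv_def)

lemma
  assumes "holo_at f z"
  shows holo_at_has_derivative: "(f has_derivative cderiv f z) (at z)"
    and cderiv_scale: "cderiv f z (c *s v) = c * cderiv f z v"
  using assms cderiv_eqI unfolding holo_at_def by metis+

text \<open>Complex homogeneity makes the derivative along a complex line multiplication by a
  complex number, which gives access to one-variable function theory.\<close>

lemma has_field_derivative_line:
  assumes "holo_at f (z + t *s v)"
  shows "((\<lambda>t. f (z + t *s v)) has_field_derivative cderiv f (z + t *s v) v) (at t)"
proof -
  have "((\<lambda>t. z + t *s v) has_derivative (\<lambda>t. t *s v)) (at t)"
    using bounded_linear.has_derivative[OF bounded_linear_vector_scalar_mult_left has_derivative_ident, of v]
    by (auto intro!: derivative_eq_intros)
  from has_derivative_compose[OF this holo_at_has_derivative[OF assms]]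
  show ?thesis
    by (simp add: has_field_derivative_def cderiv_scale[OF assms] mult_commute_abs)
qed

lemma holomorphic_on_line:
  assumes "\<And>t. t \<in> S \<Longrightarrow> holo_at f (z + t *s v)"
  shows "(\<lambda>t. f (z + t *s v)) holomorphic_on S"
  using has_field_derivative_line[OF assms]
  by (meson field_differentiable_at_within field_differentiable_def holomorphic_onI)

lemma holo_at_imp_isCont: "holo_at f z \<Longrightarrow> isCont f z"
  using holo_at_has_derivative has_derivative_continuous by blast

text \<open>Homogeneity moves the coefficients z_i into the derivative, and the expansion of z along
  the axes reassembles them: R is differentiation in the direction of the position vector.\<close>

lemma radial_deriv_eq:
  assumes "z \<in> Bd" "holo_at f z"
  shows "radial_deriv f z = cderiv f z z"
proof -
  have "partial_deriv i f z = cderiv f z (axis i 1)" for i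
  proof -
    have "(\<lambda>t. f (z + axis i t)) = (\<lambda>t. f (z + t *s axis i 1))"
      by (intro ext arg_cong[of _ _ f]) (simp add: axis_def vec_eq_iff)
    then show ?thesis
      using has_field_derivative_line[of f z 0 "axis i 1"] assms
      by (simp add: partial_deriv_def DERIV_imp_deriv)
  qed
  then have "radial_deriv f z = (\<Sum>i\<in>UNIV. cderiv f z (z $ i *s axis i 1))"
    using assms by (simp add: radial_deriv_def cderiv_scale)
  also have "\<dots> = cderiv f z (\<Sum>i\<in>UNIV. z $ i *s axis i 1)"
    by (rule linear_sum[symmetric, OF bounded_linear.linear
          [OF has_derivative_bounded_linear[OF holo_at_has_derivative[OF assms(2)]]]])
  finally show ?thesis
    by (simp add: basis_expansion)
qed

text \<open>Cauchy's inequality for the first derivative on the complex line through z in direction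
  v.\<close>

lemma cderiv_bound:
  assumes holo: "\<And>w. w \<in> ball z r \<Longrightarrow> holo_at f w" and bd: "\<And>w. w \<in> ball z r \<Longrightarrow> cmod (f w) \<le> B"
    and "0 < r"
  shows "cmod (cderiv f z v) \<le> 2 * B / r * norm v"
proof (cases "v = 0")
  case True
  then show ?thesis
    using cderiv_scale[OF holo, of z 0 0] assms(3) by simp
next
  case False
  \<comment> \<open>Half of the radius at which the line leaves the ball, so that the closed disc
    stays in the open ball. This is the factor 2 in the bound.\<close>
  define s where "s = r / (2 * norm v)"
  have s: "s > 0" using False assms(3) by (simp add: s_def)
  have mem: "z + t *s v \<in> ball z r" if "cmod t \<le> s" for t
  proof -
    have "cmod t * norm v \<le> s * norm v"
      using that by (intro mult_right_mono) auto
    also have "\<dots> < r" using False assms(3) by (simp add: s_def)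
    finally show ?thesis by (simp add: dist_norm norm_vector_scalar_mult)
  qed
  let ?g = "\<lambda>t. f (z + t *s v)"
  have hol: "?g holomorphic_on cball 0 s"
    by (rule holomorphic_on_line) (auto intro!: holo mem)
  have "cmod ((deriv ^^ 1) ?g 0) \<le> fact 1 * B / s ^ 1"
    using hol s
    by (intro Cauchy_inequality)
       (auto intro!: bd mem holomorphic_on_imp_continuous_on intro: holomorphic_on_subset)
  moreover have "deriv ?g 0 = cderiv f z v"
    using has_field_derivative_line[of f z 0 v] holo[of z] assms(3) by (simp add: DERIV_imp_deriv)
  ultimately show ?thesis
    using False by (simp add: s_def field_simps)
qed

text \<open>First-order Taylor expansion with remainder. For w in the disc of radius r/4 the disc of
  radius r/2 around w stays in the given one, and Cauchy's inequality bounds the second derivative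
  by 2! B / (r/2)^2 = 8 B / r^2.\<close>

lemma difference_quotient_bound:
  assumes hol: "g holomorphic_on cball 0 r" and bd: "\<And>t. t \<in> cball 0 r \<Longrightarrow> cmod (g t) \<le> B"
    and "0 < r" "cmod t \<le> r / 4"
  shows "cmod (g t - g 0 - deriv g 0 * t) \<le> 8 * B / r\<^sup>2 * (cmod t)\<^sup>2"
proof -
  have hol': "g holomorphic_on ball 0 r" using hol by (rule holomorphic_on_subset) auto
  have d: "cmod ((deriv ^^ 2) g w) \<le> 8 * B / r\<^sup>2" if "w \<in> cball 0 (r / 4)" for w
  proof -
    have sub: "cball w (r / 2) \<subseteq> cball 0 r"
      using that assms(3) by (simp add: cball_subset_cball_iff)
    have "cmod ((deriv ^^ 2) g w) \<le> fact 2 * B / (r / 2) ^ 2"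
    proof (rule Cauchy_inequality)
      show "g holomorphic_on ball w (r / 2)"
        using hol by (rule holomorphic_on_subset) (use sub ball_subset_cball in blast)
      show "continuous_on (cball w (r / 2)) g"
        using hol sub continuous_on_subset holomorphic_on_imp_continuous_on by blast
      show "cmod (g x) \<le> B" if "cmod (w - x) = r / 2" for x
        by (rule bd) (use that sub in \<open>auto simp: dist_norm\<close>)
    qed (use assms in simp)
    then show ?thesis by (simp add: power2_eq_square field_simps)
  qed
  have "cmod ((deriv ^^ 0) g t - (\<Sum>i\<le>1. (deriv ^^ i) g 0 * (t - 0) ^ i / fact i))
    \<le> 8 * B / r\<^sup>2 * cmod (t - 0) ^ Suc 1 / fact 1"
  proof (rule complex_Taylor[where S = "cball 0 (r / 4)"])
    show "((deriv ^^ i) g has_field_derivative (deriv ^^ Suc i) g x) (at x within cball 0 (r / 4))"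
      if "x \<in> cball 0 (r / 4)" for i x
    proof -
      have "(deriv ^^ i) g holomorphic_on ball 0 r"
        using hol' by (rule holomorphic_higher_deriv) auto
      then have "((deriv ^^ i) g has_field_derivative deriv ((deriv ^^ i) g) x) (at x)"
        by (rule holomorphic_derivI) (use that assms(3) in auto)
      then show ?thesis using DERIV_subset by fastforce
    qed
    show "cmod ((deriv ^^ Suc 1) g x) \<le> 8 * B / r\<^sup>2" if "x \<in> cball 0 (r / 4)" for x
      using d[OF that] by (simp add: numeral_2_eq_2)
  qed (use assms in auto)
  then show ?thesis by (simp add: power2_eq_square algebra_simps)
qed

text \<open>
  The radial derivative is, locally uniformly, the limit of the difference quotients
  \<open>(f (z + \<epsilon> z) - f z) / \<epsilon>\<close>; by Cauchy's estimates their derivatives converge locally uniformly too.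
\<close>

lemma holo_at_radial_deriv:
  fixes f :: "complex ^ 'd \<Rightarrow> complex"
  assumes f: "\<And>z. z \<in> Bd \<Longrightarrow> holo_at f z" and z0: "z0 \<in> Bd"
  shows "holo_at (radial_deriv f) z0"
proof -
  \<comment> \<open>A quarter of the distance to the sphere. Points of \<open>S2\<close> have norm
    at most 1 - 2\<rho>, and dilating them by 1 + t with |t| \<le> \<rho> leads into the compact
    ball of radius 1 - \<rho>, where f is bounded. The remaining room separates \<open>S\<close>
    from the boundary of \<open>S2\<close>.\<close>
  define \<rho> where "\<rho> = (1 - norm z0) / 4"
  have \<rho>: "0 < \<rho>" "\<rho> \<le> 1" and nz0: "norm z0 = 1 - 4 * \<rho>"
    using z0 norm_ge_zero[of z0] by (auto simp: \<rho>_def field_simps simp del: norm_ge_zero)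
  define S where "S = ball z0 \<rho>"
  define S2 where "S2 = ball z0 (2 * \<rho>)"
  have norm_S2: "norm z \<le> 1 - 2 * \<rho>" if "z \<in> S2" for z
    using that norm_triangle_ineq2[of z z0] by (auto simp: S2_def dist_norm norm_minus_commute nz0)
  have S2_Bd: "S2 \<subseteq> Bd" using norm_S2 \<rho>(1) by force
  have mem: "z + t *s z \<in> cball 0 (1 - \<rho>)" if "z \<in> S2" "cmod t \<le> \<rho>" for z t
  proof -
    have "norm (z + t *s z) \<le> norm z + cmod t * norm z"
      by (metis norm_triangle_ineq norm_vector_scalar_mult)
    also have "cmod t * norm z \<le> \<rho> * 1"
      using that S2_Bd \<rho>(1) by (intro mult_mono) auto
    finally show ?thesis using norm_S2[OF that(1)] by simp
  qed
  have sub1: "cball 0 (1 - \<rho>) \<subseteq> (Bd :: (complex ^ 'd) set)" using \<rho> by auto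
  have mem_Bd: "z + t *s z \<in> Bd" if "z \<in> S2" "cmod t \<le> \<rho>" for z t
    using mem[OF that] sub1 by blast
  have "continuous_on (cball 0 (1 - \<rho>)) f"
    using f sub1 by (intro continuous_at_imp_continuous_on ballI holo_at_imp_isCont) auto
  then have "bounded (f ` cball 0 (1 - \<rho>))"
    by (intro compact_imp_bounded compact_continuous_image) auto
  then obtain B where B: "\<And>z. z \<in> cball 0 (1 - \<rho>) \<Longrightarrow> cmod (f z) \<le> B" and "B > 0"
    unfolding bounded_pos by (metis imageI)
  define C where "C = 8 * B / \<rho>\<^sup>2"
  have "C > 0" using \<open>B > 0\<close> \<rho> by (simp add: C_def)
  \<comment> \<open>The sequence starts at \<rho>/4 because the remainder estimate is valid only for
    increments up to a quarter of the radius.\<close>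
  define e where "e n = \<rho> / (4 * real (Suc n))" for n
  have e: "0 < e n" "e n \<le> \<rho> / 4" for n using \<rho> by (auto simp: e_def divide_simps)
  have e0: "e \<longlonglongrightarrow> 0"
    unfolding e_def using tendsto_mult[OF tendsto_const[of "\<rho> / 4"] LIMSEQ_inverse_real_of_nat]
    by (simp add: field_simps)
  define F where "F n z = (f (z + of_real (e n) *s z) - f z) / of_real (e n)" for n z
  have F_approx: "cmod (F n z - radial_deriv f z) \<le> C * e n" if "z \<in> S2" for n z
  proof -
    let ?g = "\<lambda>t. f (z + t *s z)"
    have "cmod (?g (e n) - ?g 0 - deriv ?g 0 * e n) \<le> C * (cmod (of_real (e n)))\<^sup>2"
      unfolding C_def
    proof (rule difference_quotient_bound)
      show "?g holomorphic_on cball 0 \<rho>"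
        by (intro holomorphic_on_line f mem_Bd that) simp
      show "cmod (?g t) \<le> B" if "t \<in> cball 0 \<rho>" for t
        using mem[OF \<open>z \<in> S2\<close>] that by (intro B) auto
      show "cmod (of_real (e n)) \<le> \<rho> / 4" using e[of n] by simp
    qed (use \<rho> in simp)
    moreover have "deriv ?g 0 = radial_deriv f z"
      using has_field_derivative_line[of f z 0 z] that S2_Bd f
      by (force simp: radial_deriv_eq DERIV_imp_deriv)
    moreover have "of_real (e n) * F n z = ?g (e n) - ?g 0"
      using e(1)[of n] by (simp add: F_def)
    ultimately have "cmod (of_real (e n) * (F n z - radial_deriv f z)) \<le> C * (e n)\<^sup>2"
      by (simp add: right_diff_distrib mult.commute)
    then show ?thesis using e(1)[of n] by (simp add: norm_mult power2_eq_square)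
  qed
  have F_holo: "holo_at (F n) z" if "z \<in> S2" for n z
  proof -
    let ?w = "z + of_real (e n) *s z"
    have w: "?w \<in> Bd" "z \<in> Bd" using mem_Bd[OF that, of "of_real (e n)"] e[of n] S2_Bd that \<rho>
      by auto
    have "((\<lambda>z. of_real (e n) *s z) has_derivative (\<lambda>h. of_real (e n) *s h)) (at z)"
    proof (rule bounded_linear_imp_has_derivative, rule bounded_linear_intro)
      show "norm (complex_of_real (e n) *s v) \<le> norm v * cmod (of_real (e n))" for v :: "complex ^ 'd"
        by (simp add: norm_vector_scalar_mult)
    qed (auto simp: vec_eq_iff algebra_simps)
    then have "((\<lambda>z. z + of_real (e n) *s z) has_derivative (\<lambda>h. h + of_real (e n) *s h)) (at z)"
      by (intro derivative_intros)
    from has_derivative_compose[OF this holo_at_has_derivative[OF f[OF w(1)]]]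
    have "(F n has_derivative
        (\<lambda>h. (cderiv f ?w (h + of_real (e n) *s h) - cderiv f z h) / of_real (e n))) (at z)"
      unfolding F_def using holo_at_has_derivative[OF f[OF w(2)]] e(1)[of n]
      by (auto intro!: derivative_eq_intros simp: divide_simps)
    then show ?thesis
    proof (rule holo_atI)
      fix c and v :: "complex ^ 'd"
      have "c *s v + of_real (e n) *s (c *s v) = c *s (v + of_real (e n) *s v)"
        by (simp add: vec_eq_iff algebra_simps)
      then show "(cderiv f ?w (c *s v + of_real (e n) *s (c *s v)) - cderiv f z (c *s v)) / of_real (e n)
          = c * ((cderiv f ?w (v + of_real (e n) *s v) - cderiv f z v) / of_real (e n))"
        by (simp only: cderiv_scale[OF f] w) (simp add: algebra_simps)
    qed
  qed
  have S_S2: "S \<subseteq> S2" using \<rho> by (auto simp: S_def S2_def)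
  \<comment> \<open>The two quotients are compared through their common limit
    \<open>radial_deriv f\<close>, which bounds the difference on the ball of radius \<rho> around
    z; Cauchy's estimate passes this on to the derivatives.\<close>
  have cauchy: "cmod (cderiv (F n) z h - cderiv (F m) z h) \<le> 2 * (C * e n + C * e m) / \<rho> * norm h"
    if z: "z \<in> S" for n m z h
  proof -
    have sub: "ball z \<rho> \<subseteq> S2"
      using z by (auto simp: S_def S2_def) (smt (verit) dist_triangle)
    have der: "((\<lambda>w. F n w - F m w) has_derivative (\<lambda>h. cderiv (F n) w h - cderiv (F m) w h)) (at w)"
      if "w \<in> S2" for w
      using holo_at_has_derivative[OF F_holo[OF that]] by (intro has_derivative_diff) auto
    have "cmod (cderiv (\<lambda>w. F n w - F m w) z h) \<le> 2 * (C * e n + C * e m) / \<rho> * norm h"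
    proof (rule cderiv_bound)
      show "holo_at (\<lambda>w. F n w - F m w) w" if "w \<in> ball z \<rho>" for w
        by (rule holo_atI[OF der])
           (use that sub in \<open>auto simp: cderiv_scale[OF F_holo] algebra_simps\<close>)
      show "cmod (F n w - F m w) \<le> C * e n + C * e m" if "w \<in> ball z \<rho>" for w
        using F_approx[of w n] F_approx[of w m] that sub
          norm_triangle_ineq4[of "F n w - radial_deriv f w" "F m w - radial_deriv f w"]
        by auto
    qed (use \<rho> in simp)
    then show ?thesis using cderiv_eqI[OF der] z S_S2 by auto
  qed
  define g' where "g' z h = lim (\<lambda>n. cderiv (F n) z h)" for z h
  have lim: "(\<lambda>n. cderiv (F n) z h) \<longlonglongrightarrow> g' z h" if z: "z \<in> S" for z h
  proof -
    define K where "K = 2 * C / \<rho> * norm h"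
    have K: "0 \<le> K" using \<open>C > 0\<close> \<rho> by (simp add: K_def)
    have "Cauchy (\<lambda>n. cderiv (F n) z h)"
    proof (rule metric_CauchyI)
      fix \<epsilon> :: real assume \<epsilon>: "\<epsilon> > 0"
      have "(\<lambda>n. K * e n) \<longlonglongrightarrow> K * 0"
        using e0 by (intro tendsto_intros)
      then have "\<forall>\<^sub>F n in sequentially. K * e n < \<epsilon> / 2"
        using \<epsilon> by (intro order_tendstoD) auto
      then obtain M where M: "\<And>n. n \<ge> M \<Longrightarrow> K * e n < \<epsilon> / 2"
        by (auto simp: eventually_sequentially)
      show "\<exists>M. \<forall>m\<ge>M. \<forall>n\<ge>M. dist (cderiv (F m) z h) (cderiv (F n) z h) < \<epsilon>"
      proof (intro exI allI impI)
        fix m n assume "m \<ge> M" "n \<ge> M"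
        then have "K * e m + K * e n < \<epsilon>" using M[of m] M[of n] by simp
        moreover have "2 * (C * e m + C * e n) / \<rho> * norm h = K * e m + K * e n"
          by (simp add: K_def add_divide_distrib algebra_simps)
        ultimately show "dist (cderiv (F m) z h) (cderiv (F n) z h) < \<epsilon>"
          using cauchy[OF z, of m h n] by (simp add: dist_norm)
      qed
    qed
    then show ?thesis
      unfolding g'_def by (simp add: Cauchy_convergent_iff convergent_LIMSEQ_iff)
  qed
  \<comment> \<open>Letting m tend to infinity in \<open>cauchy\<close> yields a rate that is
    uniform in z, as differentiation of a limit requires.\<close>
  have bnd: "cmod (cderiv (F n) z h - g' z h) \<le> 2 * C / \<rho> * e n * norm h" if z: "z \<in> S" for n z h
  proof (rule LIMSEQ_le)
    show "(\<lambda>m. cmod (cderiv (F n) z h - cderiv (F m) z h)) \<longlonglongrightarrow> cmod (cderiv (F n) z h - g' z h)"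
      using lim[OF z] by (intro tendsto_intros)
    have "(\<lambda>m. 2 * (C * e n + C * e m) / \<rho> * norm h) \<longlonglongrightarrow> 2 * (C * e n + C * 0) / \<rho> * norm h"
      using e0 \<rho> by (intro tendsto_intros) auto
    then show "(\<lambda>m. 2 * (C * e n + C * e m) / \<rho> * norm h) \<longlonglongrightarrow> 2 * C / \<rho> * e n * norm h"
      by (simp add: algebra_simps)
  qed (use cauchy[OF z] in auto)
  have Flim: "(\<lambda>n. F n z) \<longlonglongrightarrow> radial_deriv f z" if "z \<in> S2" for z
  proof (rule Lim_null_comparison[THEN LIM_zero_cancel])
    show "\<forall>\<^sub>F n in sequentially. cmod (F n z - radial_deriv f z) \<le> C * e n"
      using F_approx[OF that] by simp
    show "(\<lambda>n. C * e n) \<longlonglongrightarrow> 0"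
      using tendsto_mult[OF tendsto_const[of C] e0] by simp
  qed
  have z0S: "z0 \<in> S" using \<rho> by (simp add: S_def)
  have "\<exists>g. \<forall>x\<in>S. (\<lambda>n. F n x) \<longlonglongrightarrow> g x \<and> (g has_derivative g' x) (at x within S)"
  proof (rule has_derivative_sequence)
    show "(F n has_derivative cderiv (F n) x) (at x within S)" if "x \<in> S" for n x
      using holo_at_has_derivative[OF F_holo] that S_S2 has_derivative_at_withinI by blast
    fix \<epsilon> :: real assume "\<epsilon> > 0"
    have "(\<lambda>n. 2 * C / \<rho> * e n) \<longlonglongrightarrow> 2 * C / \<rho> * 0"
      using e0 by (intro tendsto_intros)
    then have "\<forall>\<^sub>F n in sequentially. 2 * C / \<rho> * e n < \<epsilon>"
      using \<open>\<epsilon> > 0\<close> by (intro order_tendstoD) auto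
    then show "\<forall>\<^sub>F n in sequentially. \<forall>x\<in>S. \<forall>h. cmod (cderiv (F n) x h - g' x h) \<le> \<epsilon> * norm h"
    proof eventually_elim
      case (elim n)
      then show ?case
        by (meson bnd less_imp_le mult_right_mono norm_ge_zero order_trans)
    qed
  next
    show "convex S" by (simp add: S_def)
    show "(\<lambda>n. F n z0) \<longlonglongrightarrow> radial_deriv f z0" using z0S S_S2 by (intro Flim) auto
  qed (rule z0S)
  then obtain g where g: "\<And>x. x \<in> S \<Longrightarrow> (\<lambda>n. F n x) \<longlonglongrightarrow> g x"
    "\<And>x. x \<in> S \<Longrightarrow> (g has_derivative g' x) (at x within S)"
    by blast
  \<comment> \<open>The abstract limit \<open>g\<close> is identified by uniqueness of pointwise
    limits.\<close>
  have "g x = radial_deriv f x" if "x \<in> S" for x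
    using LIMSEQ_unique[OF g(1)[OF that] Flim] that S_S2 by auto
  then have "(radial_deriv f has_derivative g' z0) (at z0 within S)"
    by (intro has_derivative_transform[OF z0S _ g(2)[OF z0S]]) simp
  moreover have "at z0 within S = at z0"
    by (rule at_within_open[OF z0S]) (simp add: S_def)
  ultimately have "(radial_deriv f has_derivative g' z0) (at z0)"
    by metis
  then show ?thesis
  proof (rule holo_atI)
    fix c v
    have "(\<lambda>n. c * cderiv (F n) z0 v) \<longlonglongrightarrow> c * g' z0 v"
      using lim[OF z0S] by (intro tendsto_intros)
    moreover have "cderiv (F n) z0 (c *s v) = c * cderiv (F n) z0 v" for n
      using F_holo z0S S_S2 by (intro cderiv_scale) auto
    ultimately show "g' z0 (c *s v) = c * g' z0 v"
      using LIMSEQ_unique[OF lim[OF z0S, of "c *s v"]] by simp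
  qed
qed

section \<open>Algebra of holomorphic functions and Leibniz' rule for powers of R\<close>

lemma HolD: "f \<in> Hol \<Longrightarrow> z \<in> Bd \<Longrightarrow> holo_at f z"
  by (simp add: Hol_iff)

lemma Hol_outside: "f \<in> Hol \<Longrightarrow> z \<notin> Bd \<Longrightarrow> f z = 0"
  by (simp add: Hol_iff)

lemma
  assumes "holo_at f z" "holo_at g z"
  shows holo_at_mult: "holo_at (\<lambda>z. f z * g z) z"
    and cderiv_mult: "cderiv (\<lambda>z. f z * g z) z = (\<lambda>v. f z * cderiv g z v + cderiv f z v * g z)"
proof -
  have D: "((\<lambda>z. f z * g z) has_derivative (\<lambda>v. f z * cderiv g z v + cderiv f z v * g z)) (at z)"
    using assms by (intro has_derivative_mult holo_at_has_derivative)
  show "holo_at (\<lambda>z. f z * g z) z"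
    using D by (rule holo_atI) (simp add: cderiv_scale assms algebra_simps)
  show "cderiv (\<lambda>z. f z * g z) z = (\<lambda>v. f z * cderiv g z v + cderiv f z v * g z)"
    using D by (rule cderiv_eqI)
qed

lemma
  assumes "\<And>i. i \<in> I \<Longrightarrow> holo_at (f i) z"
  shows holo_at_lincomb: "holo_at (\<lambda>z. \<Sum>i\<in>I. c i * f i z) z"
    and cderiv_lincomb: "cderiv (\<lambda>z. \<Sum>i\<in>I. c i * f i z) z = (\<lambda>v. \<Sum>i\<in>I. c i * cderiv (f i) z v)"
proof -
  have D: "((\<lambda>z. \<Sum>i\<in>I. c i * f i z) has_derivative (\<lambda>v. \<Sum>i\<in>I. c i * cderiv (f i) z v)) (at z)"
    using assms by (intro has_derivative_sum has_derivative_mult_right holo_at_has_derivative)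
  show "holo_at (\<lambda>z. \<Sum>i\<in>I. c i * f i z) z"
    using D by (rule holo_atI) (simp add: cderiv_scale assms sum_distrib_left mult.left_commute)
  show "cderiv (\<lambda>z. \<Sum>i\<in>I. c i * f i z) z = (\<lambda>v. \<Sum>i\<in>I. c i * cderiv (f i) z v)"
    using D by (rule cderiv_eqI)
qed

lemma Hol_mult: "f \<in> Hol \<Longrightarrow> g \<in> Hol \<Longrightarrow> (\<lambda>z. f z * g z) \<in> Hol"
  by (auto simp: Hol_iff holo_at_mult)

lemma Hol_lincomb: "(\<And>i. i \<in> I \<Longrightarrow> f i \<in> Hol) \<Longrightarrow> (\<lambda>z. \<Sum>i\<in>I. c i * f i z) \<in> Hol"
  by (auto simp: Hol_iff holo_at_lincomb)

lemma Hol_sum: "(\<And>i. i \<in> I \<Longrightarrow> f i \<in> Hol) \<Longrightarrow> (\<lambda>z. \<Sum>i\<in>I. f i z) \<in> Hol"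
  using Hol_lincomb[of I f "\<lambda>_. 1"] by simp

lemma Hol_scale: "f \<in> Hol \<Longrightarrow> (\<lambda>z. c * f z) \<in> Hol"
  using Hol_lincomb[of "{()}" "\<lambda>_. f" "\<lambda>_. c"] by simp

text \<open>The constant 1 in the form in which it belongs to \<open>Hol\<close>, that is, cut off
  outside the ball. It is both the test function for columns and the cut-off for
  multipliers.\<close>

definition unit_fun :: "complex ^ 'd \<Rightarrow> complex" where
  "unit_fun z = of_bool (z \<in> Bd)"

lemma Hol_unit_fun: "unit_fun \<in> Hol"
proof -
  have "holo_at unit_fun z" if "z \<in> Bd" for z :: "complex ^ 'd"
  proof (rule holo_atI)
    show "(unit_fun has_derivative (\<lambda>_. 0)) (at z)"
      by (rule has_derivative_transform_within_open[OF has_derivative_const[of 1] open_ball that])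
         (simp add: unit_fun_def)
  qed simp
  then show ?thesis unfolding Hol_iff by (auto simp: unit_fun_def)
qed

lemma Hol_radial_deriv: "f \<in> Hol \<Longrightarrow> radial_deriv f \<in> Hol"
  unfolding Hol_iff by (metis holo_at_radial_deriv radial_deriv_def)

lemma Hol_radial_deriv_pow: "f \<in> Hol \<Longrightarrow> (radial_deriv ^^ k) f \<in> Hol"
  by (induction k) (auto intro: Hol_radial_deriv)

lemma radial_deriv_mult:
  assumes "f \<in> Hol" "g \<in> Hol"
  shows "radial_deriv (\<lambda>z. f z * g z) = (\<lambda>z. radial_deriv f z * g z + f z * radial_deriv g z)"
proof
  fix z
  show "radial_deriv (\<lambda>z. f z * g z) z = radial_deriv f z * g z + f z * radial_deriv g z"
    using HolD[OF assms(1), of z] HolD[OF assms(2), of z]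
    by (cases "z \<in> Bd") (simp_all add: radial_deriv_eq holo_at_mult cderiv_mult, simp add: radial_deriv_def)
qed

lemma radial_deriv_lincomb:
  assumes "\<And>i. i \<in> I \<Longrightarrow> f i \<in> Hol"
  shows "radial_deriv (\<lambda>z. \<Sum>i\<in>I. c i * f i z) = (\<lambda>z. \<Sum>i\<in>I. c i * radial_deriv (f i) z)"
proof
  fix z
  show "radial_deriv (\<lambda>z. \<Sum>i\<in>I. c i * f i z) z = (\<Sum>i\<in>I. c i * radial_deriv (f i) z)"
    using HolD[OF assms, of _ z]
    by (cases "z \<in> Bd") (simp_all add: radial_deriv_eq holo_at_lincomb cderiv_lincomb, simp add: radial_deriv_def)
qed

lemma radial_deriv_pow_lincomb:
  assumes "\<And>i. i \<in> I \<Longrightarrow> f i \<in> Hol"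
  shows "(radial_deriv ^^ k) (\<lambda>z. \<Sum>i\<in>I. c i * f i z) = (\<lambda>z. \<Sum>i\<in>I. c i * (radial_deriv ^^ k) (f i) z)"
  by (induction k) (simp_all add: radial_deriv_lincomb Hol_radial_deriv_pow assms)

lemma radial_deriv_pow_sum:
  assumes "\<And>i. i \<in> I \<Longrightarrow> f i \<in> Hol"
  shows "(radial_deriv ^^ k) (\<lambda>z. \<Sum>i\<in>I. f i z) = (\<lambda>z. \<Sum>i\<in>I. (radial_deriv ^^ k) (f i) z)"
  using radial_deriv_pow_lincomb[of I f k "\<lambda>_. 1"] assms by simp

lemma radial_deriv_pow_scale:
  "f \<in> Hol \<Longrightarrow> (radial_deriv ^^ k) (\<lambda>z. c * f z) = (\<lambda>z. c * (radial_deriv ^^ k) f z)"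
  using radial_deriv_pow_lincomb[of "{()}" "\<lambda>_. f" k "\<lambda>_. c"] by simp

text \<open>The coefficients z_i of R vanish at the origin. Hence the value term in the norm of
  order j > 0 is absent for functions of the form R^(k-j) f with j < k.\<close>

lemma radial_deriv_pow_at_0: "0 < k \<Longrightarrow> (radial_deriv ^^ k) f 0 = 0"
  by (cases k) (simp_all add: radial_deriv_def)

lemma radial_deriv_pow_unit_fun: "0 < k \<Longrightarrow> (radial_deriv ^^ k) unit_fun = (\<lambda>z. 0)"
proof (induction k rule: nat_induct_non_zero)
  case 1
  \<comment> \<open>The product rule applied to 1 = 1 * 1 gives R 1 = 2 R 1 on the ball, so R 1 =
    0.\<close>
  have idem: "(\<lambda>z. unit_fun z * unit_fun z) = unit_fun"
    by (auto simp: unit_fun_def)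
  have "radial_deriv unit_fun z = 0" for z
    using radial_deriv_mult[OF Hol_unit_fun Hol_unit_fun, THEN fun_cong, of z]
    unfolding idem by (cases "z \<in> Bd") (simp_all add: unit_fun_def radial_deriv_def)
  then show ?case by auto
next
  case (Suc k)
  then show ?case using radial_deriv_pow_scale[OF Hol_unit_fun, of 1 0] by simp
qed

text \<open>The innermost R is split off, so the induction hypothesis is applied to the pairs (R f,
  g) and (f, R g), and Pascal's rule merges the two sums.\<close>

lemma radial_deriv_pow_mult:
  assumes "f \<in> Hol" "g \<in> Hol"
  shows "(radial_deriv ^^ k) (\<lambda>z. f z * g z) =
    (\<lambda>z. \<Sum>j\<le>k. of_nat (k choose j) * ((radial_deriv ^^ j) f z * (radial_deriv ^^ (k - j)) g z))"
  using assms
proof (induction k arbitrary: f g)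
  case (Suc k)
  have H: "radial_deriv f \<in> Hol" "radial_deriv g \<in> Hol"
    using Suc.prems by (auto intro: Hol_radial_deriv)
  let ?t = "\<lambda>i j z. (radial_deriv ^^ i) f z * (radial_deriv ^^ j) g z"
  have eq1: "(radial_deriv ^^ Suc k) (\<lambda>z. f z * g z) =
      (radial_deriv ^^ k) (\<lambda>z. radial_deriv f z * g z + f z * radial_deriv g z)"
    by (simp only: funpow_Suc_right o_apply radial_deriv_mult[OF Suc.prems])
  \<comment> \<open>Additivity is the finite-sum lemma for a family indexed by the booleans.\<close>
  have eq2: "\<dots> = (\<lambda>z. (radial_deriv ^^ k) (\<lambda>z. radial_deriv f z * g z) z
      + (radial_deriv ^^ k) (\<lambda>z. f z * radial_deriv g z) z)"
    using radial_deriv_pow_sum[of "UNIV :: bool set"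
        "\<lambda>b. if b then (\<lambda>z. radial_deriv f z * g z) else (\<lambda>z. f z * radial_deriv g z)" k]
      Hol_mult[OF H(1) Suc.prems(2)] Hol_mult[OF Suc.prems(1) H(2)]
    by (simp add: UNIV_bool add.commute)
  show ?case
    unfolding eq1 eq2 Suc.IH[OF H(1) Suc.prems(2)] Suc.IH[OF Suc.prems(1) H(2)]
  proof
    fix z
    have "(\<Sum>j\<le>k. of_nat (k choose j) * ((radial_deriv ^^ j) (radial_deriv f) z * (radial_deriv ^^ (k - j)) g z))
        = (\<Sum>j\<le>k. of_nat (k choose j) * ?t (Suc j) (Suc k - Suc j) z)"
      by (simp add: funpow_swap1)
    \<comment> \<open>The coefficient is k choose (j - 1), with the value 0 at j = 0, so that both
      sums run over j \<le> k + 1.\<close>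
    also have "\<dots> = (\<Sum>j\<le>Suc k. of_nat (case j of 0 \<Rightarrow> 0 | Suc i \<Rightarrow> k choose i) * ?t j (Suc k - j) z)"
      by (subst sum.atMost_Suc_shift) simp
    finally have *: "(\<Sum>j\<le>k. of_nat (k choose j) * ((radial_deriv ^^ j) (radial_deriv f) z * (radial_deriv ^^ (k - j)) g z))
        = (\<Sum>j\<le>Suc k. of_nat (case j of 0 \<Rightarrow> 0 | Suc i \<Rightarrow> k choose i) * ?t j (Suc k - j) z)" .
    have "(\<Sum>j\<le>k. of_nat (k choose j) * ((radial_deriv ^^ j) f z * (radial_deriv ^^ (k - j)) (radial_deriv g) z))
        = (\<Sum>j\<le>k. of_nat (k choose j) * ?t j (Suc k - j) z)"
      by (intro sum.cong) (auto simp: Suc_diff_le funpow_swap1)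
    also have "\<dots> = (\<Sum>j\<le>Suc k. of_nat (k choose j) * ?t j (Suc k - j) z)"
      by simp
    finally have **: "(\<Sum>j\<le>k. of_nat (k choose j) * ((radial_deriv ^^ j) f z * (radial_deriv ^^ (k - j)) (radial_deriv g) z))
        = (\<Sum>j\<le>Suc k. of_nat (k choose j) * ?t j (Suc k - j) z)" .
    have "(Suc k choose j) = (case j of 0 \<Rightarrow> 0 | Suc i \<Rightarrow> k choose i) + (k choose j)" for j
      by (cases j) auto
    then show "(\<Sum>j\<le>k. of_nat (k choose j) * ((radial_deriv ^^ j) (radial_deriv f) z * (radial_deriv ^^ (k - j)) g z))
      + (\<Sum>j\<le>k. of_nat (k choose j) * ((radial_deriv ^^ j) f z * (radial_deriv ^^ (k - j)) (radial_deriv g) z))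
      = (\<Sum>j\<le>Suc k. of_nat (Suc k choose j) * ?t j (Suc k - j) z)"
      unfolding * ** by (simp only: of_nat_add distrib_right sum.distrib)
  qed
qed simp

section \<open>Square integrals against a weight\<close>

lemma cmod_sum_mult_square_le:
  "(cmod (\<Sum>i\<in>I. a i * b i))\<^sup>2 \<le> (\<Sum>i\<in>I. (cmod (a i))\<^sup>2) * (\<Sum>i\<in>I. (cmod (b i))\<^sup>2)"
proof -
  have "cmod (\<Sum>i\<in>I. a i * b i) \<le> (\<Sum>i\<in>I. cmod (a i) * cmod (b i))"
    by (metis (no_types, lifting) norm_mult norm_sum sum.cong)
  then have "(cmod (\<Sum>i\<in>I. a i * b i))\<^sup>2 \<le> (\<Sum>i\<in>I. cmod (a i) * cmod (b i))\<^sup>2"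
    by (intro power_mono) auto
  also have "\<dots> \<le> (\<Sum>i\<in>I. (cmod (a i))\<^sup>2) * (\<Sum>i\<in>I. (cmod (b i))\<^sup>2)"
    by (rule Cauchy_Schwarz_ineq_sum)
  finally show ?thesis .
qed

lemma cmod_sum_square_le: "(cmod (\<Sum>i\<in>I. a i))\<^sup>2 \<le> real (card I) * (\<Sum>i\<in>I. (cmod (a i))\<^sup>2)"
  using cmod_sum_mult_square_le[of "\<lambda>_. 1" a I] by simp

lemma cmod_add_square_le: "(cmod (a + b))\<^sup>2 \<le> 2 * (cmod a)\<^sup>2 + 2 * (cmod b)\<^sup>2"
proof -
  have "(cmod (a + b))\<^sup>2 \<le> (cmod a + cmod b)\<^sup>2"
    by (intro power_mono norm_triangle_ineq) simp
  also have "\<dots> \<le> 2 * (cmod a)\<^sup>2 + 2 * (cmod b)\<^sup>2"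
    using zero_le_power2[of "cmod a - cmod b"] by (simp add: power2_eq_square algebra_simps)
  finally show ?thesis .
qed

lemma space_V [simp]: "space V = Bd"
  by (simp add: V_def)

lemma Hol_measurable: "f \<in> Hol \<Longrightarrow> f \<in> borel_measurable V"
  unfolding V_def measurable_cong_sets[OF sets_uniform_measure refl]
  by (auto intro!: continuous_imp_measurable_on_sets_lebesgue continuous_at_imp_continuous_on
      holo_at_imp_isCont HolD)

text \<open>The squared L^2 norm adds up over families without square roots. Where the integrand is
  not integrable, its Bochner integral is 0, so nonnegativity holds for every f.\<close>

definition sq_int :: "(complex ^ 'd \<Rightarrow> real) \<Rightarrow> (complex ^ 'd \<Rightarrow> complex) \<Rightarrow> real" where
  "sq_int \<omega> f = (\<integral>z. (cmod (f z))\<^sup>2 * \<omega> z \<partial>V)"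

lemma L2_integrable: "f \<in> L2 \<omega> \<Longrightarrow> integrable V (\<lambda>z. (cmod (f z))\<^sup>2 * \<omega> z)"
  by (simp add: L2_def)

locale weight =
  fixes \<omega> :: "complex ^ 'd \<Rightarrow> real"
  assumes nonneg: "z \<in> Bd \<Longrightarrow> 0 \<le> \<omega> z" and integrable: "integrable V \<omega>"
begin

lemma sq_int_nonneg: "0 \<le> sq_int \<omega> f"
  unfolding sq_int_def by (rule Bochner_Integration.integral_nonneg) (simp add: nonneg)

text \<open>The passage from a pointwise inequality on the ball to membership and a norm estimate at
  the same time; measurability comes from holomorphy.\<close>

lemma L2_dominated:
  assumes "f \<in> Hol" and "integrable V G"
    and le: "\<And>z. z \<in> Bd \<Longrightarrow> (cmod (f z))\<^sup>2 * \<omega> z \<le> G z"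
  shows "f \<in> L2 \<omega>" "sq_int \<omega> f \<le> integral\<^sup>L V G"
proof -
  have m: "f \<in> borel_measurable V" using assms(1) by (rule Hol_measurable)
  have "integrable V (\<lambda>z. (cmod (f z))\<^sup>2 * \<omega> z)"
  proof (rule Bochner_Integration.integrable_bound[OF assms(2)])
    show "(\<lambda>z. (cmod (f z))\<^sup>2 * \<omega> z) \<in> borel_measurable V"
      using m integrable by measurable
    show "AE z in V. norm ((cmod (f z))\<^sup>2 * \<omega> z) \<le> norm (G z)"
      using le nonneg by (intro AE_I2) (force simp: abs_mult)
  qed
  then show "f \<in> L2 \<omega>" "sq_int \<omega> f \<le> integral\<^sup>L V G"
    using m assms(2) le by (auto simp: L2_def sq_int_def intro!: integral_mono)
qed

lemma L2_scale: "f \<in> L2 \<omega> \<Longrightarrow> (\<lambda>z. c * f z) \<in> L2 \<omega>"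
  by (auto simp: L2_def norm_mult power_mult_distrib mult.assoc)

lemma sq_int_scale: "sq_int \<omega> (\<lambda>z. c * f z) = (cmod c)\<^sup>2 * sq_int \<omega> f"
  by (simp add: sq_int_def norm_mult power_mult_distrib mult.assoc)

section \<open>The scale of Besov spaces with a fixed weight\<close>

lemma elems_besov: "elems (besov k \<omega>) = {f \<in> Hol. (radial_deriv ^^ k) f \<in> L2 \<omega>}"
  by (auto simp: besov_def L2a_def Hol_radial_deriv_pow)

abbreviation mass :: real where "mass \<equiv> \<integral>z. \<bar>\<omega> z\<bar> \<partial>V"

lemma vnorm_besov_square:
  "(vnorm (besov k \<omega>) f)\<^sup>2 = (if k = 0 then 0 else mass * (cmod (f 0))\<^sup>2) + sq_int \<omega> ((radial_deriv ^^ k) f)"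
  using sq_int_nonneg[of "(radial_deriv ^^ k) f"]
  by (auto simp: besov_def L2_norm_def sq_int_def)

lemma vnorm_besov_nonneg: "0 \<le> vnorm (besov k \<omega>) f"
  using sq_int_nonneg[of "(radial_deriv ^^ k) f"] by (auto simp: besov_def L2_norm_def sq_int_def)

lemma sq_int_le_vnorm_besov: "sq_int \<omega> ((radial_deriv ^^ k) f) \<le> (vnorm (besov k \<omega>) f)\<^sup>2"
  by (simp add: vnorm_besov_square)

lemma besov_scale:
  assumes "f \<in> elems (besov k \<omega>)"
  shows "(\<lambda>z. c * f z) \<in> elems (besov k \<omega>)"
    and "vnorm (besov k \<omega>) (\<lambda>z. c * f z) = cmod c * vnorm (besov k \<omega>) f"
proof -
  have f: "f \<in> Hol" using assms by (simp add: elems_besov)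
  show "(\<lambda>z. c * f z) \<in> elems (besov k \<omega>)"
    using assms by (auto simp: elems_besov Hol_scale radial_deriv_pow_scale L2_scale)
  have "(vnorm (besov k \<omega>) (\<lambda>z. c * f z))\<^sup>2 = (cmod c * vnorm (besov k \<omega>) f)\<^sup>2"
    by (simp add: vnorm_besov_square radial_deriv_pow_scale f sq_int_scale power_mult_distrib
        norm_mult algebra_simps)
  then show "vnorm (besov k \<omega>) (\<lambda>z. c * f z) = cmod c * vnorm (besov k \<omega>) f"
    by (simp add: power2_eq_iff_nonneg vnorm_besov_nonneg)
qed

text \<open>Since R^j R^(k-j) = R^k, both norms have the same integral part, and for j < k the
  function R^(k-j) f vanishes at the origin.\<close>

lemma besov_radial_deriv_pow:
  assumes "f \<in> elems (besov k \<omega>)" "j \<le> k"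
  shows "(radial_deriv ^^ (k - j)) f \<in> elems (besov j \<omega>)"
    and "(vnorm (besov j \<omega>) ((radial_deriv ^^ (k - j)) f))\<^sup>2 \<le> (vnorm (besov k \<omega>) f)\<^sup>2"
proof -
  have eq: "(radial_deriv ^^ j) ((radial_deriv ^^ (k - j)) f) = (radial_deriv ^^ k) f"
    using assms(2) by (metis funpow_add le_add_diff_inverse o_apply)
  show "(radial_deriv ^^ (k - j)) f \<in> elems (besov j \<omega>)"
    using assms(1) by (simp add: elems_besov eq Hol_radial_deriv_pow)
  show "(vnorm (besov j \<omega>) ((radial_deriv ^^ (k - j)) f))\<^sup>2 \<le> (vnorm (besov k \<omega>) f)\<^sup>2"
    using assms(2) by (cases "j = k") (auto simp: vnorm_besov_square eq radial_deriv_pow_at_0)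
qed

end

text \<open>Boundedness of the column by K, phrased with finite sums so that neither summability nor
  a supremum has to be carried along. Only K^2 occurs, hence the sign conditions on K in later
  lemmas.\<close>

definition column_bound ::
  "('a \<Rightarrow> complex) normed_carrier \<Rightarrow> (nat \<Rightarrow> 'a \<Rightarrow> complex) \<Rightarrow> real \<Rightarrow> bool" where
  "column_bound X \<Phi> K \<longleftrightarrow> (\<forall>f\<in>elems X. (\<forall>n. (\<lambda>z. \<Phi> n z * f z) \<in> elems X) \<and>
     (\<forall>A. finite A \<longrightarrow> (\<Sum>n\<in>A. (vnorm X (\<lambda>z. \<Phi> n z * f z))\<^sup>2) \<le> K\<^sup>2 * (vnorm X f)\<^sup>2))"

section \<open>Columns of derivatives and finite rows\<close>

context weight
begin

text \<open>The column of the R^k phi_n maps the space of order k into L^2(\<omega>). The constant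
  is fixed before the column and its bound K, which makes the final estimate uniform.\<close>

definition deriv_bound :: "nat \<Rightarrow> real \<Rightarrow> bool" where
  "deriv_bound k C \<longleftrightarrow> 0 \<le> C \<and>
    (\<forall>\<Phi> K f A. (\<forall>n. \<Phi> n \<in> Hol) \<longrightarrow> (\<forall>j\<le>k. column_bound (besov j \<omega>) \<Phi> K) \<longrightarrow>
      f \<in> elems (besov k \<omega>) \<longrightarrow> finite A \<longrightarrow>
      (\<forall>n. (\<lambda>z. (radial_deriv ^^ k) (\<Phi> n) z * f z) \<in> L2 \<omega>) \<and>
      (\<Sum>n\<in>A. sq_int \<omega> (\<lambda>z. (radial_deriv ^^ k) (\<Phi> n) z * f z))
        \<le> C * (K\<^sup>2 * (vnorm (besov k \<omega>) f)\<^sup>2))"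

lemma deriv_boundD:
  assumes "deriv_bound k C" "\<forall>n. \<Phi> n \<in> Hol" "\<forall>j\<le>k. column_bound (besov j \<omega>) \<Phi> K"
    "f \<in> elems (besov k \<omega>)"
  shows "(\<lambda>z. (radial_deriv ^^ k) (\<Phi> n) z * f z) \<in> L2 \<omega>"
    and "finite A \<Longrightarrow> (\<Sum>n\<in>A. sq_int \<omega> (\<lambda>z. (radial_deriv ^^ k) (\<Phi> n) z * f z))
        \<le> C * (K\<^sup>2 * (vnorm (besov k \<omega>) f)\<^sup>2)"
  using assms unfolding deriv_bound_def by blast+

text \<open>
  Leibniz' rule expresses \<open>(R\<^sup>k \<phi>) f\<close> by \<open>R\<^sup>k (\<phi> f)\<close> and the products
  \<open>(R\<^sup>j \<phi>) (R\<^sup>k\<^sup>-\<^sup>j f)\<close> with \<open>j < k\<close>, where \<open>R\<^sup>k\<^sup>-\<^sup>j f\<close> lies in the space of order \<open>j\<close>.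
\<close>

lemma ex_deriv_bound: "\<exists>C. deriv_bound k C"
proof (induction k rule: less_induct)
  case (less k)
  let ?T = "\<lambda>k \<phi> f z. (radial_deriv ^^ k) \<phi> z * f z"
  obtain C where C: "\<And>j. j < k \<Longrightarrow> deriv_bound j (C j)"
    using less.IH by metis
  then have C0: "C j \<ge> 0" if "j < k" for j
    using that by (simp add: deriv_bound_def)
  \<comment> \<open>The 2 separates R^k (phi f) from the other Leibniz terms, k comes from
    Cauchy-Schwarz over the k indices j < k, and the binomial coefficient appears squared.\<close>
  define b where "b j = 2 * real k * (real (k choose j))\<^sup>2" for j
  have b0: "b j \<ge> 0" for j by (simp add: b_def)
  have main: "?T k (\<Phi> n) f \<in> L2 \<omega> \<and>
      (\<Sum>n\<in>A. sq_int \<omega> (?T k (\<Phi> n) f)) \<le> (2 + (\<Sum>j<k. b j * C j)) * (K\<^sup>2 * (vnorm (besov k \<omega>) f)\<^sup>2)"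
    if \<Phi>: "\<forall>n. \<Phi> n \<in> Hol" and cb: "\<forall>j\<le>k. column_bound (besov j \<omega>) \<Phi> K"
      and f: "f \<in> elems (besov k \<omega>)" and A: "finite A" for \<Phi> K f A n
  proof -
    define M where "M = K\<^sup>2 * (vnorm (besov k \<omega>) f)\<^sup>2"
    have fH: "f \<in> Hol" using f by (simp add: elems_besov)
    let ?P = "\<lambda>n. (radial_deriv ^^ k) (\<lambda>z. \<Phi> n z * f z)"
    let ?S = "\<lambda>j n. ?T j (\<Phi> n) ((radial_deriv ^^ (k - j)) f)"
    have S: "?S j n \<in> L2 \<omega>" "(\<Sum>n\<in>A. sq_int \<omega> (?S j n)) \<le> C j * M" if "j < k" for j n
    proof -
      have cb': "\<forall>i\<le>j. column_bound (besov i \<omega>) \<Phi> K" using cb that by auto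
      note * = deriv_boundD[OF C[OF that] \<Phi> cb' besov_radial_deriv_pow(1)[OF f less_imp_le[OF that]]]
      show "?S j n \<in> L2 \<omega>" by (rule *(1))
      have "(\<Sum>n\<in>A. sq_int \<omega> (?S j n))
          \<le> C j * (K\<^sup>2 * (vnorm (besov j \<omega>) ((radial_deriv ^^ (k - j)) f))\<^sup>2)"
        by (rule *(2)) (rule A)
      also have "\<dots> \<le> C j * M"
        unfolding M_def using C0 that
        by (intro mult_left_mono besov_radial_deriv_pow(2)[OF f]) auto
      finally show "(\<Sum>n\<in>A. sq_int \<omega> (?S j n)) \<le> C j * M" .
    qed
    have elem: "(\<lambda>z. \<Phi> n z * f z) \<in> elems (besov k \<omega>)" for n
      using cb f by (auto simp: column_bound_def)
    then have P: "?P n \<in> L2 \<omega>" for n by (simp add: elems_besov)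
    define G where "G n z = 2 * ((cmod (?P n z))\<^sup>2 * \<omega> z) + (\<Sum>j<k. b j * ((cmod (?S j n z))\<^sup>2 * \<omega> z))" for n z
    have G: "integrable V (G n)" for n
      unfolding G_def
      by (intro Bochner_Integration.integrable_add Bochner_Integration.integrable_sum
          integrable_mult_right L2_integrable P S) auto
    have intG: "integral\<^sup>L V (G n) = 2 * sq_int \<omega> (?P n) + (\<Sum>j<k. b j * sq_int \<omega> (?S j n))" for n
    proof -
      have "integral\<^sup>L V (G n) = (\<integral>z. 2 * ((cmod (?P n z))\<^sup>2 * \<omega> z) \<partial>V) +
          (\<integral>z. (\<Sum>j<k. b j * ((cmod (?S j n z))\<^sup>2 * \<omega> z)) \<partial>V)"
        unfolding G_def
        by (intro Bochner_Integration.integral_add Bochner_Integration.integrable_sum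
            integrable_mult_right L2_integrable P S) auto
      also have "(\<integral>z. (\<Sum>j<k. b j * ((cmod (?S j n z))\<^sup>2 * \<omega> z)) \<partial>V) =
          (\<Sum>j<k. \<integral>z. b j * ((cmod (?S j n z))\<^sup>2 * \<omega> z) \<partial>V)"
        by (intro Bochner_Integration.integral_sum integrable_mult_right L2_integrable S) auto
      finally show ?thesis by (simp add: sq_int_def)
    qed
    have le: "(cmod (?T k (\<Phi> n) f z))\<^sup>2 * \<omega> z \<le> G n z" if "z \<in> Bd" for n z
    proof -
      have "?P n z = (\<Sum>j\<le>k. of_nat (k choose j) * ?S j n z)"
        using radial_deriv_pow_mult[of "\<Phi> n" f k] \<Phi> fH by simp
      also have "\<dots> = ?T k (\<Phi> n) f z + (\<Sum>j<k. of_nat (k choose j) * ?S j n z)"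
        by (simp flip: lessThan_Suc_atMost)
      \<comment> \<open>Leibniz' rule is solved for its term j = k, in which f is not
        differentiated.\<close>
      finally have eq: "?T k (\<Phi> n) f z = ?P n z + (- (\<Sum>j<k. of_nat (k choose j) * ?S j n z))"
        by simp
      have "(cmod (?T k (\<Phi> n) f z))\<^sup>2 \<le>
          2 * (cmod (?P n z))\<^sup>2 + 2 * (cmod (\<Sum>j<k. of_nat (k choose j) * ?S j n z))\<^sup>2"
        unfolding eq using cmod_add_square_le[of "?P n z" "- (\<Sum>j<k. of_nat (k choose j) * ?S j n z)"]
        by simp
      also have "(cmod (\<Sum>j<k. of_nat (k choose j) * ?S j n z))\<^sup>2 \<le>
          real k * (\<Sum>j<k. (cmod (of_nat (k choose j) * ?S j n z))\<^sup>2)"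
        using cmod_sum_square_le[of "\<lambda>j. of_nat (k choose j) * ?S j n z" "{..<k}"] by simp
      finally have "(cmod (?T k (\<Phi> n) f z))\<^sup>2 \<le>
          2 * (cmod (?P n z))\<^sup>2 + (\<Sum>j<k. b j * (cmod (?S j n z))\<^sup>2)"
        by (simp add: b_def norm_mult power_mult_distrib sum_distrib_left mult.assoc)
      then have "(cmod (?T k (\<Phi> n) f z))\<^sup>2 * \<omega> z \<le>
          (2 * (cmod (?P n z))\<^sup>2 + (\<Sum>j<k. b j * (cmod (?S j n z))\<^sup>2)) * \<omega> z"
        using nonneg that by (intro mult_right_mono) auto
      then show ?thesis by (simp add: G_def distrib_right sum_distrib_right mult.assoc)
    qed
    have TH: "?T k (\<Phi> n) f \<in> Hol" for n
      using \<Phi> fH by (intro Hol_mult Hol_radial_deriv_pow) auto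
    have "(\<Sum>n\<in>A. sq_int \<omega> (?T k (\<Phi> n) f)) \<le>
        (\<Sum>n\<in>A. 2 * sq_int \<omega> (?P n) + (\<Sum>j<k. b j * sq_int \<omega> (?S j n)))"
      by (intro sum_mono order_trans[OF L2_dominated(2)[OF TH G le] eq_refl[OF intG]])
    also have "\<dots> = 2 * (\<Sum>n\<in>A. sq_int \<omega> (?P n)) + (\<Sum>j<k. b j * (\<Sum>n\<in>A. sq_int \<omega> (?S j n)))"
      unfolding sum.distrib sum.swap[of _ "{..<k}"] by (simp add: sum_distrib_left)
    \<comment> \<open>The first sum is bounded by the column bound in order k itself, the sums with
      j < k by the induction hypothesis.\<close>
    also have "\<dots> \<le> 2 * M + (\<Sum>j<k. b j * (C j * M))"
    proof (intro add_mono mult_left_mono sum_mono)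
      have "(\<Sum>n\<in>A. sq_int \<omega> (?P n)) \<le> (\<Sum>n\<in>A. (vnorm (besov k \<omega>) (\<lambda>z. \<Phi> n z * f z))\<^sup>2)"
        by (intro sum_mono sq_int_le_vnorm_besov)
      also have "\<dots> \<le> M"
        using cb f A by (auto simp: column_bound_def M_def)
      finally show "(\<Sum>n\<in>A. sq_int \<omega> (?P n)) \<le> M" .
    qed (use S(2) b0 in auto)
    also have "\<dots> = (2 + (\<Sum>j<k. b j * C j)) * M"
      by (simp add: distrib_right sum_distrib_right mult.assoc)
    finally show ?thesis
      using L2_dominated(1)[OF TH G le] by (simp add: M_def)
  qed
  have "0 \<le> 2 + (\<Sum>j<k. b j * C j)"
    using C0 b0 by (intro add_nonneg_nonneg sum_nonneg) auto
  with main have "deriv_bound k (2 + (\<Sum>j<k. b j * C j))"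
    unfolding deriv_bound_def by blast
  then show ?case by blast
qed

lemma mass_nonneg: "0 \<le> mass"
  by simp

lemma unit_fun_in_besov: "unit_fun \<in> elems (besov k \<omega>)"
proof (cases "k = 0")
  case True
  have "unit_fun \<in> L2 \<omega>"
    by (rule L2_dominated(1)[OF Hol_unit_fun integrable]) (simp add: unit_fun_def)
  then show ?thesis by (simp add: True elems_besov Hol_unit_fun)
qed (simp add: elems_besov Hol_unit_fun radial_deriv_pow_unit_fun L2_def)

text \<open>The column is tested on the constant 1, whose squared norm is exactly
  \<open>mass\<close>; the value terms of the products give the left side. Keeping
  \<open>mass\<close> on both sides avoids a division.\<close>

lemma column_bound_at_0:
  assumes "column_bound (besov k \<omega>) \<Phi> K" "0 < k" "finite A"
  shows "mass * (\<Sum>n\<in>A. (cmod (\<Phi> n 0))\<^sup>2) \<le> K\<^sup>2 * mass"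
proof -
  have "mass * (\<Sum>n\<in>A. (cmod (\<Phi> n 0))\<^sup>2) \<le> (\<Sum>n\<in>A. (vnorm (besov k \<omega>) (\<lambda>z. \<Phi> n z * unit_fun z))\<^sup>2)"
    unfolding sum_distrib_left using assms(2)
    by (intro sum_mono) (simp add: vnorm_besov_square sq_int_nonneg unit_fun_def)
  also have "\<dots> \<le> K\<^sup>2 * (vnorm (besov k \<omega>) unit_fun)\<^sup>2"
    using assms(1,3) unit_fun_in_besov by (auto simp: column_bound_def)
  also have "(vnorm (besov k \<omega>) unit_fun)\<^sup>2 = mass"
    using assms(2) by (simp add: vnorm_besov_square radial_deriv_pow_unit_fun sq_int_def unit_fun_def)
  finally show ?thesis .
qed

lemma finite_row_bound:
  obtains C where "0 \<le> C"
    "\<And>\<Phi> K h A. \<forall>n. \<Phi> n \<in> Hol \<Longrightarrow> \<forall>j\<le>N. column_bound (besov j \<omega>) \<Phi> K \<Longrightarrow>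
      \<forall>n. h n \<in> elems (besov N \<omega>) \<Longrightarrow> finite A \<Longrightarrow>
      (vnorm (besov N \<omega>) (\<lambda>z. \<Sum>n\<in>A. \<Phi> n z * h n z))\<^sup>2 \<le>
        C * (K\<^sup>2 * (\<Sum>n\<in>A. (vnorm (besov N \<omega>) (h n))\<^sup>2))"
proof -
  let ?T = "\<lambda>k \<phi> f z. (radial_deriv ^^ k) \<phi> z * f z"
  obtain C where C: "\<And>j. deriv_bound j (C j)"
    using ex_deriv_bound by metis
  then have C0: "C j \<ge> 0" for j
    by (simp add: deriv_bound_def)
  \<comment> \<open>Cauchy-Schwarz over the N + 1 Leibniz terms gives the first factor, the binomial
    coefficients the second.\<close>
  define b where "b j = real (Suc N) * (real (N choose j))\<^sup>2" for j
  have b0: "b j \<ge> 0" for j by (simp add: b_def)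
  \<comment> \<open>The summand 1 in the constant pays for the value at the origin.\<close>
  have main: "(vnorm (besov N \<omega>) (\<lambda>z. \<Sum>n\<in>A. \<Phi> n z * h n z))\<^sup>2 \<le>
       (1 + (\<Sum>j\<le>N. b j * C j)) * (K\<^sup>2 * (\<Sum>n\<in>A. (vnorm (besov N \<omega>) (h n))\<^sup>2))"
    if \<Phi>: "\<forall>n. \<Phi> n \<in> Hol" and cb: "\<forall>j\<le>N. column_bound (besov j \<omega>) \<Phi> K"
      and h: "\<forall>n. h n \<in> elems (besov N \<omega>)" and A: "finite A" for \<Phi> K h A
  proof -
    define M where "M = K\<^sup>2 * (\<Sum>n\<in>A. (vnorm (besov N \<omega>) (h n))\<^sup>2)"
    have hH: "h n \<in> Hol" for n using h by (simp add: elems_besov)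
    let ?f = "\<lambda>z. \<Sum>n\<in>A. \<Phi> n z * h n z"
    \<comment> \<open>Leibniz' rule produces only the diagonal n = m; the independent second index
      anticipates the double sum.\<close>
    let ?S = "\<lambda>j n m. ?T j (\<Phi> n) ((radial_deriv ^^ (N - j)) (h m))"
    have fH: "?f \<in> Hol" using \<Phi> hH by (intro Hol_sum Hol_mult) auto
    have S: "?S j n m \<in> L2 \<omega>"
      "(\<Sum>n\<in>A. sq_int \<omega> (?S j n m)) \<le> C j * (K\<^sup>2 * (vnorm (besov N \<omega>) (h m))\<^sup>2)"
      if "j \<le> N" for j n m
    proof -
      have cb': "\<forall>i\<le>j. column_bound (besov i \<omega>) \<Phi> K" using cb that by auto
      note * = deriv_boundD[OF C \<Phi> cb' besov_radial_deriv_pow(1)[OF h[rule_format] that]]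
      show "?S j n m \<in> L2 \<omega>" by (rule *(1))
      have "(\<Sum>n\<in>A. sq_int \<omega> (?S j n m))
          \<le> C j * (K\<^sup>2 * (vnorm (besov j \<omega>) ((radial_deriv ^^ (N - j)) (h m)))\<^sup>2)"
        by (rule *(2)) (rule A)
      also have "\<dots> \<le> C j * (K\<^sup>2 * (vnorm (besov N \<omega>) (h m))\<^sup>2)"
        using C0 that h by (intro mult_left_mono besov_radial_deriv_pow(2)) auto
      finally show "(\<Sum>n\<in>A. sq_int \<omega> (?S j n m)) \<le> C j * (K\<^sup>2 * (vnorm (besov N \<omega>) (h m))\<^sup>2)" .
    qed
    define G where "G z = (\<Sum>j\<le>N. \<Sum>m\<in>A. \<Sum>n\<in>A. b j * ((cmod (?S j n m z))\<^sup>2 * \<omega> z))" for z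
    have G: "integrable V G"
      unfolding G_def
      by (intro Bochner_Integration.integrable_sum integrable_mult_right L2_integrable S) auto
    have "integral\<^sup>L V G = (\<Sum>j\<le>N. \<integral>z. (\<Sum>m\<in>A. \<Sum>n\<in>A. b j * ((cmod (?S j n m z))\<^sup>2 * \<omega> z)) \<partial>V)"
      unfolding G_def
      by (intro Bochner_Integration.integral_sum Bochner_Integration.integrable_sum
          integrable_mult_right L2_integrable S) auto
    also have "\<dots> = (\<Sum>j\<le>N. \<Sum>m\<in>A. \<integral>z. (\<Sum>n\<in>A. b j * ((cmod (?S j n m z))\<^sup>2 * \<omega> z)) \<partial>V)"
      by (intro sum.cong refl Bochner_Integration.integral_sum Bochner_Integration.integrable_sum
          integrable_mult_right L2_integrable S) auto
    also have "\<dots> = (\<Sum>j\<le>N. \<Sum>m\<in>A. \<Sum>n\<in>A. \<integral>z. b j * ((cmod (?S j n m z))\<^sup>2 * \<omega> z) \<partial>V)"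
      by (intro sum.cong refl Bochner_Integration.integral_sum
          integrable_mult_right L2_integrable S) auto
    finally have intG: "integral\<^sup>L V G = (\<Sum>j\<le>N. b j * (\<Sum>m\<in>A. \<Sum>n\<in>A. sq_int \<omega> (?S j n m)))"
      by (simp add: sq_int_def sum_distrib_left)
    have le: "(cmod ((radial_deriv ^^ N) ?f z))\<^sup>2 * \<omega> z \<le> G z" if "z \<in> Bd" for z
    proof -
      have "(radial_deriv ^^ N) ?f z = (\<Sum>n\<in>A. (radial_deriv ^^ N) (\<lambda>z. \<Phi> n z * h n z) z)"
        using \<Phi> hH by (subst radial_deriv_pow_sum) (auto intro: Hol_mult)
      also have "\<dots> = (\<Sum>n\<in>A. \<Sum>j\<le>N. of_nat (N choose j) * ?S j n n z)"
        using \<Phi> hH by (simp add: radial_deriv_pow_mult)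
      also have "\<dots> = (\<Sum>j\<le>N. of_nat (N choose j) * (\<Sum>n\<in>A. ?S j n n z))"
        by (subst sum.swap) (simp add: sum_distrib_left)
      finally have "(cmod ((radial_deriv ^^ N) ?f z))\<^sup>2 =
          (cmod (\<Sum>j\<le>N. of_nat (N choose j) * (\<Sum>n\<in>A. ?S j n n z)))\<^sup>2" by simp
      also have "\<dots> \<le> real (Suc N) * (\<Sum>j\<le>N. (cmod (of_nat (N choose j) * (\<Sum>n\<in>A. ?S j n n z)))\<^sup>2)"
        using cmod_sum_square_le[of _ "{..N}"] by simp
      also have "\<dots> = (\<Sum>j\<le>N. b j * (cmod (\<Sum>n\<in>A. ?S j n n z))\<^sup>2)"
        unfolding sum_distrib_left[of "real (Suc N)"]
        by (intro sum.cong refl) (simp add: b_def norm_mult power_mult_distrib)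
      \<comment> \<open>The decoupling step: the second sum is renamed to m, and from here on the
        derivatives of the whole column multiply each h_m.\<close>
      also have "\<dots> \<le> (\<Sum>j\<le>N. b j * ((\<Sum>n\<in>A. (cmod ((radial_deriv ^^ j) (\<Phi> n) z))\<^sup>2) *
          (\<Sum>m\<in>A. (cmod ((radial_deriv ^^ (N - j)) (h m) z))\<^sup>2)))"
        by (intro sum_mono mult_left_mono cmod_sum_mult_square_le b0)
      also have "\<dots> = (\<Sum>j\<le>N. \<Sum>m\<in>A. \<Sum>n\<in>A. b j * (cmod (?S j n m z))\<^sup>2)"
        by (simp add: sum_distrib_left sum_distrib_right norm_mult power_mult_distrib mult.assoc)
      finally have "(cmod ((radial_deriv ^^ N) ?f z))\<^sup>2 * \<omega> z \<le>
          (\<Sum>j\<le>N. \<Sum>m\<in>A. \<Sum>n\<in>A. b j * (cmod (?S j n m z))\<^sup>2) * \<omega> z"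
        using nonneg that by (intro mult_right_mono) auto
      then show ?thesis by (simp add: G_def sum_distrib_right mult.assoc)
    qed
    have "sq_int \<omega> ((radial_deriv ^^ N) ?f) \<le> (\<Sum>j\<le>N. b j * (\<Sum>m\<in>A. \<Sum>n\<in>A. sq_int \<omega> (?S j n m)))"
      using L2_dominated(2)[OF Hol_radial_deriv_pow[OF fH] G le] intG by simp
    also have "\<dots> \<le> (\<Sum>j\<le>N. b j * (\<Sum>m\<in>A. C j * (K\<^sup>2 * (vnorm (besov N \<omega>) (h m))\<^sup>2)))"
      by (intro sum_mono mult_left_mono S(2) b0) auto
    also have "\<dots> = (\<Sum>j\<le>N. b j * C j) * M"
      by (simp add: M_def sum_distrib_right mult.assoc flip: sum_distrib_left)
    finally have deriv_part: "sq_int \<omega> ((radial_deriv ^^ N) ?f) \<le> (\<Sum>j\<le>N. b j * C j) * M" .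
    \<comment> \<open>The same decoupling for the numbers phi_n(0) and h_n(0).\<close>
    have "mass * (cmod (?f 0))\<^sup>2 \<le> M" if "0 < N"
    proof -
      have "mass * (cmod (?f 0))\<^sup>2 \<le> mass * ((\<Sum>n\<in>A. (cmod (\<Phi> n 0))\<^sup>2) * (\<Sum>n\<in>A. (cmod (h n 0))\<^sup>2))"
        by (intro mult_left_mono cmod_sum_mult_square_le mass_nonneg)
      also have "\<dots> \<le> (K\<^sup>2 * mass) * (\<Sum>n\<in>A. (cmod (h n 0))\<^sup>2)"
        unfolding mult.assoc[symmetric, of mass]
        using cb that A by (intro mult_right_mono column_bound_at_0[of N]) (auto intro: sum_nonneg)
      also have "\<dots> = K\<^sup>2 * (\<Sum>n\<in>A. mass * (cmod (h n 0))\<^sup>2)"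
        by (simp add: sum_distrib_left mult.assoc)
      also have "\<dots> \<le> M"
        unfolding M_def using that
        by (intro mult_left_mono sum_mono) (simp_all add: vnorm_besov_square sq_int_nonneg)
      finally show ?thesis .
    qed
    moreover have "M \<ge> 0" by (simp add: M_def sum_nonneg)
    ultimately have "(if N = 0 then 0 else mass * (cmod (?f 0))\<^sup>2) \<le> M" by auto
    with deriv_part show ?thesis
      unfolding vnorm_besov_square[of _ ?f] by (simp add: distrib_right flip: M_def)
  qed
  have "0 \<le> 1 + (\<Sum>j\<le>N. b j * C j)"
    using C0 b0 by (intro add_nonneg_nonneg sum_nonneg) auto
  then show ?thesis using main by (rule that)
qed

end

section \<open>Function spaces with a homogeneous norm\<close>

text \<open>Common ground of \<open>H\<close> and the Besov spaces for passing between operator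
  norms and column bounds: vectors can be rescaled to the unit ball. The norm may vanish on nonzero
  elements.\<close>

locale homogeneous =
  fixes X :: "('a \<Rightarrow> complex) normed_carrier"
  assumes zero: "(\<lambda>z. 0) \<in> elems X"
    and scale: "f \<in> elems X \<Longrightarrow> (\<lambda>z. c * f z) \<in> elems X"
    and vnorm_scale: "f \<in> elems X \<Longrightarrow> vnorm X (\<lambda>z. c * f z) = cmod c * vnorm X f"
    and vnorm_nonneg: "f \<in> elems X \<Longrightarrow> 0 \<le> vnorm X f"
begin

lemma vnorm_zero: "vnorm X (\<lambda>z. 0) = 0"
  using vnorm_scale[OF zero, of 0] by simp

lemma
  assumes "\<Phi> \<in> MC X"
  shows column_bound_column_norm: "column_bound X \<Phi> (column_norm X \<Phi>)"
    and column_norm_nonneg: "0 \<le> column_norm X \<Phi>"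
proof -
  define s where "s f = sqrt (\<Sum>n. (vnorm X (\<lambda>z. \<Phi> n z * f z))\<^sup>2)" for f
  have mult: "(\<lambda>z. \<Phi> n z * f z) \<in> elems X" if "f \<in> elems X" for f n
    using assms that by (auto simp: MC_def Mult_def)
  obtain C where summ: "\<And>f. f \<in> elems X \<Longrightarrow> summable (\<lambda>n. (vnorm X (\<lambda>z. \<Phi> n z * f z))\<^sup>2)"
    and "\<forall>f\<in>elems X. s f \<le> C * vnorm X f"
    using assms by (auto simp: MC_def bounded_operator_def direct_sum_def column_op_def s_def)
  then have C: "s f \<le> C * vnorm X f" if "f \<in> elems X" for f
    using that by blast
  have cn: "column_norm X \<Phi> = (SUP f\<in>{f \<in> elems X. vnorm X f \<le> 1}. s f)"
    by (simp add: column_norm_def operator_norm_def direct_sum_def column_op_def s_def)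
  \<comment> \<open>A real supremum is informative only over a bounded set. The constant C may be
    negative, hence its absolute value.\<close>
  have bdd: "bdd_above (s ` {f \<in> elems X. vnorm X f \<le> 1})"
  proof (rule bdd_aboveI2)
    fix f assume f: "f \<in> {f \<in> elems X. vnorm X f \<le> 1}"
    have "s f \<le> \<bar>C\<bar> * vnorm X f"
      using f by (intro order_trans[OF C mult_right_mono[OF abs_ge_self]]) (auto simp: vnorm_nonneg)
    also have "\<dots> \<le> \<bar>C\<bar> * 1" using f by (intro mult_left_mono) auto
    finally show "s f \<le> \<bar>C\<bar>" by simp
  qed
  have s_nonneg: "0 \<le> s f" if "f \<in> elems X" for f
    unfolding s_def using summ[OF that] by (simp add: suminf_nonneg)
  have s_scale: "s (\<lambda>z. c * f z) = cmod c * s f" if "f \<in> elems X" for c f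
  proof -
    have "(vnorm X (\<lambda>z. \<Phi> n z * (c * f z)))\<^sup>2 = (cmod c)\<^sup>2 * (vnorm X (\<lambda>z. \<Phi> n z * f z))\<^sup>2" for n
      using vnorm_scale[OF mult[OF that], of c n]
      by (simp add: mult.left_commute flip: power_mult_distrib)
    then show ?thesis
      using suminf_mult[OF summ[OF that], of "(cmod c)\<^sup>2"] by (simp add: s_def real_sqrt_mult)
  qed
  have le: "s f \<le> column_norm X \<Phi> * vnorm X f" if f: "f \<in> elems X" for f
  proof (cases "vnorm X f = 0")
    case True
    \<comment> \<open>An element of norm 0 cannot be normalized; here the bound with C already gives
      \<open>s f\<close> \<le> 0.\<close>
    then show ?thesis using C[OF f] by simp
  next
    case False
    then have pos: "vnorm X f > 0" using vnorm_nonneg[OF f] by simp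
    let ?g = "\<lambda>z. of_real (inverse (vnorm X f)) * f z"
    have "s ?g \<le> column_norm X \<Phi>"
      unfolding cn by (rule cSUP_upper[OF _ bdd]) (use pos f in \<open>auto simp: scale vnorm_scale norm_inverse\<close>)
    then show ?thesis
      unfolding s_scale[OF f] using pos by (simp add: norm_divide field_simps)
  qed
  show nn: "0 \<le> column_norm X \<Phi>"
    unfolding cn by (rule order_trans[OF s_nonneg[OF zero] cSUP_upper[OF _ bdd]])
      (simp add: zero vnorm_zero)
  show "column_bound X \<Phi> (column_norm X \<Phi>)"
    unfolding column_bound_def
  proof (intro ballI conjI allI impI mult)
    fix f :: "'a \<Rightarrow> complex" and A :: "nat set" assume f: "f \<in> elems X" and "finite A"
    then have "(\<Sum>n\<in>A. (vnorm X (\<lambda>z. \<Phi> n z * f z))\<^sup>2) \<le> (\<Sum>n. (vnorm X (\<lambda>z. \<Phi> n z * f z))\<^sup>2)"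
      by (intro sum_le_suminf summ) auto
    also have "\<dots> = (s f)\<^sup>2"
      using summ[OF f] by (simp add: s_def suminf_nonneg)
    also have "\<dots> \<le> (column_norm X \<Phi> * vnorm X f)\<^sup>2"
      using le[OF f] s_nonneg[OF f] by (intro power_mono)
    finally show "(\<Sum>n\<in>A. (vnorm X (\<lambda>z. \<Phi> n z * f z))\<^sup>2) \<le> (column_norm X \<Phi>)\<^sup>2 * (vnorm X f)\<^sup>2"
      by (simp add: power_mult_distrib)
  qed
qed

lemma
  assumes cb: "column_bound X \<Phi> K" and "0 \<le> K"
  shows column_bound_imp_MC: "\<Phi> \<in> MC X" and column_norm_le: "column_norm X \<Phi> \<le> K"
proof -
  have mult: "(\<lambda>z. \<Phi> n z * f z) \<in> elems X" if "f \<in> elems X" for f n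
    using cb that by (auto simp: column_bound_def)
  have bd: "(\<Sum>n<m. (vnorm X (\<lambda>z. \<Phi> n z * f z))\<^sup>2) \<le> K\<^sup>2 * (vnorm X f)\<^sup>2" if "f \<in> elems X" for f m
    using cb that by (auto simp: column_bound_def)
  have summ: "summable (\<lambda>n. (vnorm X (\<lambda>z. \<Phi> n z * f z))\<^sup>2)" if "f \<in> elems X" for f
    by (rule summableI_nonneg_bounded[OF _ bd[OF that]]) simp
  have le: "sqrt (\<Sum>n. (vnorm X (\<lambda>z. \<Phi> n z * f z))\<^sup>2) \<le> K * vnorm X f" if "f \<in> elems X" for f
  proof (rule real_le_lsqrt)
    show "(\<Sum>n. (vnorm X (\<lambda>z. \<Phi> n z * f z))\<^sup>2) \<le> (K * vnorm X f)\<^sup>2"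
      using suminf_le_const[OF summ[OF that] bd[OF that]] by (simp add: power_mult_distrib)
  qed (use vnorm_nonneg[OF that] assms(2) in simp)
  show "\<Phi> \<in> MC X"
    using mult summ le
    by (auto simp: MC_def Mult_def bounded_operator_def direct_sum_def column_op_def intro!: exI[of _ K])
  show "column_norm X \<Phi> \<le> K"
    unfolding column_norm_def operator_norm_def
  proof (rule cSUP_least)
    show "{f \<in> elems X. vnorm X f \<le> 1} \<noteq> {}" using zero vnorm_zero by auto
    fix f assume f: "f \<in> {f \<in> elems X. vnorm X f \<le> 1}"
    then have "vnorm (direct_sum X) (column_op \<Phi> f) \<le> K * vnorm X f"
      using le by (simp add: direct_sum_def column_op_def)
    also have "\<dots> \<le> K * 1" using f assms(2) by (intro mult_left_mono) auto
    finally show "vnorm (direct_sum X) (column_op \<Phi> f) \<le> K" by simp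
  qed
qed

end

lemma column_bound_mono:
  assumes "column_bound X \<Phi> K" "0 \<le> K" "K \<le> K'"
  shows "column_bound X \<Phi> K'"
proof -
  have "K\<^sup>2 * (vnorm X f)\<^sup>2 \<le> K'\<^sup>2 * (vnorm X f)\<^sup>2" for f
    using assms by (intro mult_right_mono power_mono) auto
  then show ?thesis
    using assms(1) unfolding column_bound_def by (meson order_trans)
qed

text \<open>The image norm costs the factor b, the norm of the argument the factor 1/a.\<close>

lemma column_bound_equivalent:
  assumes cb: "column_bound X \<Phi> K" and "elems X = elems Y" "0 < a" "0 < b"
    and le: "\<And>f. f \<in> elems X \<Longrightarrow> a * vnorm X f \<le> vnorm Y f \<and> vnorm Y f \<le> b * vnorm X f"
    and nn: "\<And>f. f \<in> elems X \<Longrightarrow> 0 \<le> vnorm X f"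
  shows "column_bound Y \<Phi> (b / a * K)"
  unfolding column_bound_def
proof (intro ballI conjI allI impI)
  fix f n assume "f \<in> elems Y"
  then show "(\<lambda>z. \<Phi> n z * f z) \<in> elems Y" using cb assms(2) by (auto simp: column_bound_def)
next
  fix f :: "'a \<Rightarrow> complex" and A :: "nat set" assume "f \<in> elems Y" and A: "finite A"
  then have f: "f \<in> elems X" using assms(2) by simp
  have mult: "(\<lambda>z. \<Phi> n z * f z) \<in> elems X" for n
    using cb f by (auto simp: column_bound_def)
  have "vnorm X f \<le> vnorm Y f / a"
    using le[OF f] assms(3) by (simp add: field_simps)
  then have *: "(vnorm X f)\<^sup>2 \<le> (vnorm Y f / a)\<^sup>2"
    using nn[OF f] by (intro power_mono)
  have "0 \<le> vnorm Y (\<lambda>z. \<Phi> n z * f z)" for n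
    using le[OF mult] nn[OF mult] assms(3) by (meson mult_nonneg_nonneg less_imp_le order_trans)
  then have "(\<Sum>n\<in>A. (vnorm Y (\<lambda>z. \<Phi> n z * f z))\<^sup>2) \<le> (\<Sum>n\<in>A. (b * vnorm X (\<lambda>z. \<Phi> n z * f z))\<^sup>2)"
    using le[OF mult] by (intro sum_mono power_mono) auto
  also have "\<dots> = b\<^sup>2 * (\<Sum>n\<in>A. (vnorm X (\<lambda>z. \<Phi> n z * f z))\<^sup>2)"
    by (simp add: power_mult_distrib sum_distrib_left)
  also have "\<dots> \<le> b\<^sup>2 * (K\<^sup>2 * (vnorm X f)\<^sup>2)"
    using cb f A by (intro mult_left_mono) (auto simp: column_bound_def)
  also have "\<dots> \<le> b\<^sup>2 * (K\<^sup>2 * (vnorm Y f / a)\<^sup>2)"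
    using * by (intro mult_left_mono) auto
  finally show "(\<Sum>n\<in>A. (vnorm Y (\<lambda>z. \<Phi> n z * f z))\<^sup>2) \<le> (b / a * K)\<^sup>2 * (vnorm Y f)\<^sup>2"
    by (simp add: power_mult_distrib power_divide)
qed

section \<open>Row operators on Hilbert function spaces\<close>

locale hilbert_fun =
  fixes D :: "'a set" and X :: "('a \<Rightarrow> complex) normed_carrier"
  assumes hilbert: "hilbert_function_space D X"
begin

lemma add: "f \<in> elems X \<Longrightarrow> g \<in> elems X \<Longrightarrow> (\<lambda>z. f z + g z) \<in> elems X"
  using hilbert by (simp add: hilbert_function_space_def)

sublocale homogeneous X
proof
  show zero: "(\<lambda>z. 0) \<in> elems X" and scale: "\<And>f c. f \<in> elems X \<Longrightarrow> (\<lambda>z. c * f z) \<in> elems X"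
    using hilbert by (simp_all add: hilbert_function_space_def)
  obtain ip where ip: "inner_product_on (elems X) ip"
    and vn: "\<And>f. f \<in> elems X \<Longrightarrow> vnorm X f = sqrt (Re (ip f f))"
    using hilbert by (auto simp: hilbert_function_space_def)
  have ip_scale: "ip (\<lambda>z. c * f z) g = c * ip f g" if "f \<in> elems X" "g \<in> elems X" for f g c
    using ip that unfolding inner_product_on_def by blast
  have ip_cnj: "ip g f = cnj (ip f g)" if "f \<in> elems X" "g \<in> elems X" for f g
    using ip that unfolding inner_product_on_def by blast
  fix f c assume f: "f \<in> elems X"
  have cf: "(\<lambda>z. c * f z) \<in> elems X" using f by (rule scale)
  have "ip (\<lambda>z. c * f z) (\<lambda>z. c * f z) = c * cnj (c * ip f f)"
    unfolding ip_scale[OF f cf] ip_cnj[OF cf f] ip_scale[OF f f] by (rule refl)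
  also have "\<dots> = of_real ((cmod c)\<^sup>2) * ip f f"
    by (simp add: complex_norm_square ip_cnj[OF f f, symmetric] mult_ac del: of_real_power)
  finally show "vnorm X (\<lambda>z. c * f z) = cmod c * vnorm X f"
    using f scale by (simp add: vn real_sqrt_mult del: of_real_power)
  \<comment> \<open>Positivity is postulated only for nonzero functions; for 0 it follows from
    homogeneity.\<close>
  have "0 \<le> Re (ip f f)"
  proof (cases "f = (\<lambda>z. 0)")
    case True
    then show ?thesis using ip_scale[OF zero zero, of 0] by simp
  next
    case False
    then have "0 < Re (ip f f)" using ip f unfolding inner_product_on_def by blast
    then show ?thesis by simp
  qed
  then show "0 \<le> vnorm X f" using f by (simp add: vn)
qed

lemma complete:
  assumes "\<And>n. f n \<in> elems X"
    and "\<And>e. e > 0 \<Longrightarrow> \<exists>M::nat. \<forall>m\<ge>M. \<forall>n\<ge>M. vnorm X (\<lambda>z. f m z - f n z) < e"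
  shows "\<exists>g\<in>elems X. (\<lambda>n. vnorm X (\<lambda>z. f n z - g z)) \<longlonglongrightarrow> 0"
proof -
  have "(\<forall>n. f n \<in> elems X) \<and> (\<forall>e>0. \<exists>M::nat. \<forall>m\<ge>M. \<forall>n\<ge>M. vnorm X (\<lambda>z. f m z - f n z) < e)
      \<longrightarrow> (\<exists>g\<in>elems X. (\<lambda>n. vnorm X (\<lambda>z. f n z - g z)) \<longlonglongrightarrow> 0)"
    using hilbert unfolding hilbert_function_space_def
    by (elim conjE) (erule allE[where x = f], assumption)
  then show ?thesis using assms by simp
qed

lemma evaluation_bounded: "z \<in> D \<Longrightarrow> \<exists>C. \<forall>f\<in>elems X. cmod (f z) \<le> C * vnorm X f"
  using hilbert unfolding hilbert_function_space_def by blast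

lemma diff: "f \<in> elems X \<Longrightarrow> g \<in> elems X \<Longrightarrow> (\<lambda>z. f z - g z) \<in> elems X"
  using add[OF _ scale[of g "-1"], of f] by simp

lemma vnorm_diff_commute:
  "f \<in> elems X \<Longrightarrow> g \<in> elems X \<Longrightarrow> vnorm X (\<lambda>z. f z - g z) = vnorm X (\<lambda>z. g z - f z)"
  using vnorm_scale[OF diff[of f g], of "-1"] by simp

lemma finite_sum: "(\<And>n. n \<in> A \<Longrightarrow> f n \<in> elems X) \<Longrightarrow> (\<lambda>z. \<Sum>n\<in>A. f n z) \<in> elems X"
  by (induction A rule: infinite_finite_induct) (simp_all add: zero add)

text \<open>Expanding 0 \<le> ||f - g||^2 bounds the mixed term. This replaces the triangle
  inequality and suffices up to a constant.\<close>

lemma vnorm_add_square_le: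
  assumes f: "f \<in> elems X" and g: "g \<in> elems X"
  shows "(vnorm X (\<lambda>z. f z + g z))\<^sup>2 \<le> 2 * (vnorm X f)\<^sup>2 + 2 * (vnorm X g)\<^sup>2"
proof -
  obtain ip where ip: "inner_product_on (elems X) ip"
    and vn: "\<And>f. f \<in> elems X \<Longrightarrow> vnorm X f = sqrt (Re (ip f f))"
    using hilbert by (auto simp: hilbert_function_space_def)
  have sq: "(vnorm X h)\<^sup>2 = Re (ip h h)" if "h \<in> elems X" for h
    using vnorm_nonneg[OF that] vn[OF that] by (metis real_sqrt_ge_0_iff real_sqrt_pow2)
  have expand: "Re (ip (\<lambda>z. u z + v z) (\<lambda>z. u z + v z)) = Re (ip u u) + 2 * Re (ip u v) + Re (ip v v)"
    if "u \<in> elems X" "v \<in> elems X" for u v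
  proof -
    have add_l: "ip (\<lambda>z. u z + v z) w = ip u w + ip v w" if "w \<in> elems X" for w
      using ip \<open>u \<in> elems X\<close> \<open>v \<in> elems X\<close> that unfolding inner_product_on_def by blast
    have Re_sym: "Re (ip w w') = Re (ip w' w)" if "w \<in> elems X" "w' \<in> elems X" for w w'
    proof -
      have "ip w w' = cnj (ip w' w)"
        using ip that unfolding inner_product_on_def by blast
      then show ?thesis by simp
    qed
    show ?thesis
      using add_l[OF add[OF that]] add_l[OF that(1)] add_l[OF that(2)]
        Re_sym[OF that(1) add[OF that]] Re_sym[OF that(2) add[OF that]] Re_sym[OF that]
      by simp
  qed
  let ?g = "\<lambda>z. -1 * g z"
  have g': "?g \<in> elems X" using scale[OF g, of "-1"] by simp
  have "ip ?g f = - ip g f"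
    using ip f g scale unfolding inner_product_on_def by (metis mult_minus1)
  moreover have "ip f ?g = cnj (ip ?g f)" "ip f g = cnj (ip g f)"
    using ip f g g' unfolding inner_product_on_def by blast+
  ultimately have neg: "Re (ip f ?g) = - Re (ip f g)" by simp
  have sqg: "(vnorm X ?g)\<^sup>2 = (vnorm X g)\<^sup>2" using vnorm_scale[OF g, of "-1"] by simp
  have "0 \<le> (vnorm X (\<lambda>z. f z + ?g z))\<^sup>2" by simp
  then have "2 * Re (ip f g) \<le> (vnorm X f)\<^sup>2 + (vnorm X g)\<^sup>2"
    unfolding sq[OF add[OF f g']] expand[OF f g'] neg sq[OF f, symmetric] sq[OF g', symmetric] sqg
    by simp
  then show ?thesis
    unfolding sq[OF add[OF f g]] expand[OF f g] sq[OF f, symmetric] sq[OF g, symmetric] by simp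
qed

text \<open>The bound applied to blocks {m..<p} shows that the partial sums are Cauchy, and bounded
  point evaluations identify their limit with the pointwise series.\<close>

lemma
  assumes outside: "\<And>f z. f \<in> elems X \<Longrightarrow> z \<notin> D \<Longrightarrow> f z = 0"
    and mult: "\<And>n. \<Phi> n \<in> Mult X" and "0 \<le> M"
    and bound: "\<And>h A. (\<And>n. h n \<in> elems X) \<Longrightarrow> finite A \<Longrightarrow>
      (vnorm X (\<lambda>z. \<Sum>n\<in>A. \<Phi> n z * h n z))\<^sup>2 \<le> M\<^sup>2 * (\<Sum>n\<in>A. (vnorm X (h n))\<^sup>2)"
  shows finite_row_bound_imp_MR: "\<Phi> \<in> MR X" and finite_row_bound_imp_row_norm: "row_norm X \<Phi> \<le> 2 * M"
proof -
  have main: "row_op \<Phi> h \<in> elems X \<and>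
      (\<lambda>m. vnorm X (\<lambda>z. (\<Sum>n<m. \<Phi> n z * h n z) - row_op \<Phi> h z)) \<longlonglongrightarrow> 0 \<and>
      vnorm X (row_op \<Phi> h) \<le> 2 * M * vnorm (direct_sum X) h"
    if "h \<in> elems (direct_sum X)" for h
  proof -
    have h: "\<And>n. h n \<in> elems X" and summ: "summable (\<lambda>n. (vnorm X (h n))\<^sup>2)"
      using that by (auto simp: direct_sum_def)
    define S where "S m z = (\<Sum>n<m. \<Phi> n z * h n z)" for m z
    have "(\<lambda>z. \<Phi> n z * h n z) \<in> elems X" for n
      using mult h by (simp add: Mult_def)
    then have S: "S m \<in> elems X" for m
      unfolding S_def by (intro finite_sum) auto
    \<comment> \<open>Dividing by M + 1 covers M = 0, and M / (M + 1) < 1 makes the final inequality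
      strict.\<close>
    have step: "vnorm X (\<lambda>z. S p z - S m z) < e"
      if "e > 0" "m \<le> p" and small: "(\<Sum>n=m..<p. (vnorm X (h n))\<^sup>2) < (e / (M + 1))\<^sup>2" for e m p
    proof (rule power2_less_imp_less)
      have "(\<lambda>z. S p z - S m z) = (\<lambda>z. \<Sum>n=m..<p. \<Phi> n z * h n z)"
        using sum_diff_nat_ivl[of 0 m p "\<lambda>n. \<Phi> n _ * h n _"] \<open>m \<le> p\<close>
        by (simp add: S_def fun_eq_iff atLeast0LessThan)
      then have "(vnorm X (\<lambda>z. S p z - S m z))\<^sup>2 \<le> M\<^sup>2 * (\<Sum>n=m..<p. (vnorm X (h n))\<^sup>2)"
        using bound[of h "{m..<p}"] h by simp
      also have "\<dots> \<le> M\<^sup>2 * (e / (M + 1))\<^sup>2"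
        using small by (intro mult_left_mono) auto
      also have "\<dots> = (M * e / (M + 1))\<^sup>2" by (simp add: power_mult_distrib power_divide)
      also have "\<dots> < e\<^sup>2"
        using \<open>e > 0\<close> \<open>0 \<le> M\<close> by (intro power_strict_mono) (auto simp: field_simps)
      finally show "(vnorm X (\<lambda>z. S p z - S m z))\<^sup>2 < e\<^sup>2" .
    qed (use \<open>e > 0\<close> in simp)
    have "\<exists>L. \<forall>m\<ge>L. \<forall>p\<ge>L. vnorm X (\<lambda>z. S m z - S p z) < e" if "e > 0" for e
    proof -
      have "(e / (M + 1))\<^sup>2 > 0" using that \<open>0 \<le> M\<close> by simp
      then obtain L where L: "\<And>m p. m \<ge> L \<Longrightarrow> \<bar>\<Sum>n=m..<p. (vnorm X (h n))\<^sup>2\<bar> < (e / (M + 1))\<^sup>2"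
        using summ unfolding summable_Cauchy real_norm_def by meson
      have small: "(\<Sum>n=m..<p. (vnorm X (h n))\<^sup>2) < (e / (M + 1))\<^sup>2" if "m \<ge> L" for m p
        using L[OF that, of p] by linarith
      have "vnorm X (\<lambda>z. S m z - S p z) < e" if "m \<ge> L" "p \<ge> L" for m p
        using step[OF \<open>e > 0\<close> _ small] that vnorm_diff_commute[OF S S]
        by (cases "m \<le> p") (metis, metis nle_le)
      then show ?thesis by blast
    qed
    then obtain g where g: "g \<in> elems X" and lim: "(\<lambda>m. vnorm X (\<lambda>z. S m z - g z)) \<longlonglongrightarrow> 0"
      using complete[of S] S by auto
    have "(\<lambda>m. S m z) \<longlonglongrightarrow> g z" for z
    proof (cases "z \<in> D")
      case True
      then obtain C where C: "\<And>f. f \<in> elems X \<Longrightarrow> cmod (f z) \<le> C * vnorm X f"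
        using evaluation_bounded by blast
      have "(\<lambda>m. S m z - g z) \<longlonglongrightarrow> 0"
      proof (rule Lim_null_comparison)
        show "\<forall>\<^sub>F m in sequentially. cmod (S m z - g z) \<le> C * vnorm X (\<lambda>z. S m z - g z)"
          using C[OF diff[OF S g]] by simp
        show "(\<lambda>m. C * vnorm X (\<lambda>z. S m z - g z)) \<longlonglongrightarrow> 0"
          using tendsto_mult[OF tendsto_const[of C] lim] by simp
      qed
      then show ?thesis by (rule LIM_zero_cancel)
    next
      case False
      \<comment> \<open>Off \<open>D\<close> no evaluation estimate is given, but there all elements
        vanish.\<close>
      then have "S m z = g z" for m using outside[OF S] outside[OF g] by simp
      then show ?thesis by simp
    qed
    then have "(\<lambda>n. \<Phi> n z * h n z) sums g z" for z
      by (simp add: sums_def S_def)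
    then have row: "row_op \<Phi> h = g"
      by (auto simp: row_op_def sums_unique[symmetric])
    define T where "T = (\<Sum>n. (vnorm X (h n))\<^sup>2)"
    have T: "0 \<le> T" unfolding T_def using summ by (simp add: suminf_nonneg)
    \<comment> \<open>In the limit this gives ||g||^2 \<le> 2 M^2 T; the factor sqrt 2 is rounded up
      to 2 in the row norm.\<close>
    have "(vnorm X g)\<^sup>2 \<le> 2 * (vnorm X (\<lambda>z. S m z - g z))\<^sup>2 + 2 * (M\<^sup>2 * T)" for m
    proof -
      have "(vnorm X g)\<^sup>2 \<le> 2 * (vnorm X (\<lambda>z. g z - S m z))\<^sup>2 + 2 * (vnorm X (S m))\<^sup>2"
        using vnorm_add_square_le[OF diff[OF g S[of m]] S[of m]] by simp
      moreover have "(vnorm X (S m))\<^sup>2 \<le> M\<^sup>2 * (\<Sum>n<m. (vnorm X (h n))\<^sup>2)"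
        unfolding S_def by (intro bound h) auto
      moreover have "M\<^sup>2 * (\<Sum>n<m. (vnorm X (h n))\<^sup>2) \<le> M\<^sup>2 * T"
        unfolding T_def by (intro mult_left_mono sum_le_suminf summ) auto
      ultimately show ?thesis using vnorm_diff_commute[OF g S[of m]] by simp
    qed
    moreover have "(\<lambda>m. 2 * (vnorm X (\<lambda>z. S m z - g z))\<^sup>2 + 2 * (M\<^sup>2 * T)) \<longlonglongrightarrow> 2 * 0\<^sup>2 + 2 * (M\<^sup>2 * T)"
      by (intro tendsto_intros lim)
    ultimately have "(vnorm X g)\<^sup>2 \<le> 2 * 0\<^sup>2 + 2 * (M\<^sup>2 * T)"
      by (intro LIMSEQ_le_const) auto
    also have "\<dots> \<le> (2 * M * sqrt T)\<^sup>2"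
      using T by (simp add: power_mult_distrib mult_right_mono)
    finally have "vnorm X g \<le> 2 * M * sqrt T"
      by (rule power2_le_imp_le) (use T \<open>0 \<le> M\<close> in simp)
    then show ?thesis
      using g lim by (simp add: row S_def T_def direct_sum_def)
  qed
  then show "\<Phi> \<in> MR X"
    using mult unfolding MR_def bounded_operator_def by blast
  show "row_norm X \<Phi> \<le> 2 * M"
    unfolding row_norm_def operator_norm_def
  proof (rule cSUP_least)
    have "(\<lambda>n z. 0) \<in> elems (direct_sum X)" "vnorm (direct_sum X) (\<lambda>n z. 0) = 0"
      by (simp_all add: direct_sum_def zero vnorm_zero)
    then show "{h \<in> elems (direct_sum X). vnorm (direct_sum X) h \<le> 1} \<noteq> {}"
      by (metis (mono_tags, lifting) empty_Collect_eq zero_le_one)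
    fix h assume h: "h \<in> {h \<in> elems (direct_sum X). vnorm (direct_sum X) h \<le> 1}"
    then have "vnorm X (row_op \<Phi> h) \<le> 2 * M * vnorm (direct_sum X) h"
      using main by simp
    also have "\<dots> \<le> 2 * M * 1" using h \<open>0 \<le> M\<close> by (intro mult_left_mono) auto
    finally show "vnorm X (row_op \<Phi> h) \<le> 2 * M" by simp
  qed
qed

end

section \<open>Use of the multiplier inclusion condition and the final estimate\<close>

context weight
begin

lemma homogeneous_besov: "homogeneous (besov k \<omega>)"
proof
  show "(\<lambda>z. 0) \<in> elems (besov k \<omega>)"
    using besov_scale(1)[OF unit_fun_in_besov, of 0] by simp
qed (simp_all add: besov_scale vnorm_besov_nonneg)

text \<open>The condition compares consecutive orders only. Descending from N multiplies the
  constants, and the sum of the resulting constants serves all orders at once.\<close>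

lemma multiplier_chain:
  assumes "\<And>k. k < N \<Longrightarrow> MC (besov (Suc k) \<omega>) \<subseteq> MC (besov k \<omega>) \<and>
      (\<exists>c. \<forall>\<Phi>\<in>MC (besov (Suc k) \<omega>). column_norm (besov k \<omega>) \<Phi> \<le> c * column_norm (besov (Suc k) \<omega>) \<Phi>)"
  shows "\<exists>L\<ge>0. \<forall>\<Phi>\<in>MC (besov N \<omega>). \<forall>j\<le>N.
      column_bound (besov j \<omega>) \<Phi> (L * column_norm (besov N \<omega>) \<Phi>)"
proof -
  note nn = homogeneous.column_norm_nonneg[OF homogeneous_besov]
  have "\<exists>L\<ge>0. \<forall>\<Phi>\<in>MC (besov N \<omega>). \<Phi> \<in> MC (besov j \<omega>) \<and>
      column_norm (besov j \<omega>) \<Phi> \<le> L * column_norm (besov N \<omega>) \<Phi>" if "j \<le> N" for j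
    using that
  proof (induction rule: inc_induct)
    case base
    then show ?case by (intro exI[of _ 1]) simp
  next
    case (step j)
    then obtain L where L: "L \<ge> 0" "\<And>\<Phi>. \<Phi> \<in> MC (besov N \<omega>) \<Longrightarrow> \<Phi> \<in> MC (besov (Suc j) \<omega>) \<and>
      column_norm (besov (Suc j) \<omega>) \<Phi> \<le> L * column_norm (besov N \<omega>) \<Phi>" by blast
    obtain c where c: "MC (besov (Suc j) \<omega>) \<subseteq> MC (besov j \<omega>)"
      "\<And>\<Phi>. \<Phi> \<in> MC (besov (Suc j) \<omega>) \<Longrightarrow> column_norm (besov j \<omega>) \<Phi> \<le> c * column_norm (besov (Suc j) \<omega>) \<Phi>"
      using assms[of j] step.hyps by auto
    have "column_norm (besov j \<omega>) \<Phi> \<le> \<bar>c\<bar> * L * column_norm (besov N \<omega>) \<Phi>" if "\<Phi> \<in> MC (besov N \<omega>)" for \<Phi>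
    proof -
      have "column_norm (besov j \<omega>) \<Phi> \<le> c * column_norm (besov (Suc j) \<omega>) \<Phi>"
        using c(2) L(2)[OF that] by blast
      also have "\<dots> \<le> \<bar>c\<bar> * column_norm (besov (Suc j) \<omega>) \<Phi>"
        using nn L(2)[OF that] by (intro mult_right_mono) auto
      also have "\<dots> \<le> \<bar>c\<bar> * (L * column_norm (besov N \<omega>) \<Phi>)"
        using L(2)[OF that] by (intro mult_left_mono) auto
      finally show ?thesis by simp
    qed
    then show ?case
      using c(1) L by (intro exI[of _ "\<bar>c\<bar> * L"]) auto
  qed
  then obtain L where L: "\<And>j. j \<le> N \<Longrightarrow> L j \<ge> 0"
    "\<And>j \<Phi>. j \<le> N \<Longrightarrow> \<Phi> \<in> MC (besov N \<omega>) \<Longrightarrow> \<Phi> \<in> MC (besov j \<omega>) \<and>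
      column_norm (besov j \<omega>) \<Phi> \<le> L j * column_norm (besov N \<omega>) \<Phi>"
    by metis
  show ?thesis
  proof (intro exI[of _ "\<Sum>j\<le>N. L j"] conjI ballI allI impI)
    show "0 \<le> (\<Sum>j\<le>N. L j)" using L(1) by (intro sum_nonneg) auto
    fix \<Phi> j assume \<Phi>: "\<Phi> \<in> MC (besov N \<omega>)" and j: "j \<le> N"
    have "L j \<le> (\<Sum>j\<le>N. L j)" using j L(1) by (intro member_le_sum) auto
    then have "L j * column_norm (besov N \<omega>) \<Phi> \<le> (\<Sum>j\<le>N. L j) * column_norm (besov N \<omega>) \<Phi>"
      using nn[OF \<Phi>] by (intro mult_right_mono)
    then show "column_bound (besov j \<omega>) \<Phi> ((\<Sum>j\<le>N. L j) * column_norm (besov N \<omega>) \<Phi>)"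
      using L(2)[OF j \<Phi>] nn
      by (intro column_bound_mono[OF homogeneous.column_bound_column_norm[OF homogeneous_besov]]) auto
  qed
qed

text \<open>
  Multipliers are arbitrary off the ball, hence need not lie in \<open>Hol\<close>; multiplying them by
  \<open>unit_fun\<close> repairs this without changing the operators.
\<close>

lemma column_bound_times_unit_fun:
  assumes "column_bound (besov k \<omega>) \<Phi> K"
  shows "column_bound (besov k \<omega>) (\<lambda>n z. \<Phi> n z * unit_fun z) K"
proof -
  have "(\<lambda>z. \<Phi> n z * unit_fun z * f z) = (\<lambda>z. \<Phi> n z * f z)" if "f \<in> elems (besov k \<omega>)" for f n
    using that Hol_outside by (fastforce simp: elems_besov unit_fun_def)
  then show ?thesis using assms by (simp add: column_bound_def)
qed

end

theorem theorem1p5: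
  fixes H :: "(complex ^ 'd \<Rightarrow> complex) normed_carrier"
  assumes "weighted_besov_space H"
    and "multiplier_inclusion_condition H"
  shows "MC H \<subseteq> MR H \<and>
         (\<exists>c>0. \<forall>\<Phi>\<in>MC H. row_norm H \<Phi> \<le> c * column_norm H \<Phi>)"
proof -
  interpret hilbert_fun Bd H
    using assms(1) by unfold_locales (simp add: weighted_besov_space_def)
  have HHol: "elems H \<subseteq> Hol" using assms(1) by (simp add: weighted_besov_space_def)
  obtain \<omega> N where adm: "admissible_weight \<omega>" and equiv: "equivalent_spaces H (besov N \<omega>)"
    and incl: "\<And>k. k < N \<Longrightarrow> MC (besov (Suc k) \<omega>) \<subseteq> MC (besov k \<omega>) \<and>
      (\<exists>c. \<forall>\<Phi>\<in>MC (besov (Suc k) \<omega>). column_norm (besov k \<omega>) \<Phi> \<le> c * column_norm (besov (Suc k) \<omega>) \<Phi>)"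
    using assms(2) unfolding multiplier_inclusion_condition_def by blast
  interpret weight \<omega>
    using adm by unfold_locales (auto simp: admissible_weight_def)
  interpret B: homogeneous "besov N \<omega>" by (rule homogeneous_besov)
  obtain a b where ab: "0 < a" "0 < b" and eq: "elems H = elems (besov N \<omega>)"
    and le: "\<And>f. f \<in> elems H \<Longrightarrow> a * vnorm H f \<le> vnorm (besov N \<omega>) f \<and> vnorm (besov N \<omega>) f \<le> b * vnorm H f"
    using equiv unfolding equivalent_spaces_def by auto
  obtain L where L: "L \<ge> 0" "\<And>\<Phi> j. \<Phi> \<in> MC (besov N \<omega>) \<Longrightarrow> j \<le> N \<Longrightarrow>
      column_bound (besov j \<omega>) \<Phi> (L * column_norm (besov N \<omega>) \<Phi>)"
    using multiplier_chain[OF incl] by metis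
  obtain C where C: "0 \<le> C"
    "\<And>\<Phi> K h A. \<forall>n. \<Phi> n \<in> Hol \<Longrightarrow> \<forall>j\<le>N. column_bound (besov j \<omega>) \<Phi> K \<Longrightarrow>
      \<forall>n. h n \<in> elems (besov N \<omega>) \<Longrightarrow> finite A \<Longrightarrow>
      (vnorm (besov N \<omega>) (\<lambda>z. \<Sum>n\<in>A. \<Phi> n z * h n z))\<^sup>2 \<le>
        C * (K\<^sup>2 * (\<Sum>n\<in>A. (vnorm (besov N \<omega>) (h n))\<^sup>2))"
    by (rule finite_row_bound[of N]) (rule that, assumption, blast)
  \<comment> \<open>The inner b/a transfers the column from \<open>H\<close> to the Besov space, L
    carries it down to the lower orders, sqrt C comes from the estimate of squared row norms, and
    the outer b/a returns to \<open>H\<close>.\<close>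
  define c where "c = sqrt C * (L * (b / a)) * (b / a)"
  have c: "c \<ge> 0" using C(1) L(1) ab by (simp add: c_def)
  have main: "\<Phi> \<in> MR H \<and> row_norm H \<Phi> \<le> 2 * (c * column_norm H \<Phi>)" if \<Phi>: "\<Phi> \<in> MC H" for \<Phi>
  proof -
    define \<kappa> where "\<kappa> = column_norm H \<Phi>"
    have \<kappa>: "0 \<le> \<kappa>" unfolding \<kappa>_def by (rule column_norm_nonneg[OF \<Phi>])
    have "column_bound (besov N \<omega>) \<Phi> (b / a * \<kappa>)"
      using column_bound_column_norm[OF \<Phi>] eq ab le vnorm_nonneg unfolding \<kappa>_def
      by (rule column_bound_equivalent)
    then have \<Phi>B: "\<Phi> \<in> MC (besov N \<omega>)" and cnB: "column_norm (besov N \<omega>) \<Phi> \<le> b / a * \<kappa>"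
      using B.column_bound_imp_MC B.column_norm_le ab \<kappa> by auto
    define K where "K = L * (b / a) * \<kappa>"
    have "L * column_norm (besov N \<omega>) \<Phi> \<le> K"
      unfolding K_def mult.assoc using cnB L(1) by (intro mult_left_mono)
    then have cb: "column_bound (besov j \<omega>) \<Phi> K" if "j \<le> N" for j
      using L(1) B.column_norm_nonneg[OF \<Phi>B] by (intro column_bound_mono[OF L(2)[OF \<Phi>B that]]) auto
    define \<Psi> where "\<Psi> = (\<lambda>n z. \<Phi> n z * unit_fun z)"
    have \<Psi>cb: "\<forall>j\<le>N. column_bound (besov j \<omega>) \<Psi> K"
      unfolding \<Psi>_def using column_bound_times_unit_fun cb by blast
    \<comment> \<open>Holomorphy of the truncated multipliers is obtained by letting them act on the
      constant 1.\<close>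
    have "(\<lambda>z. \<Phi> n z * unit_fun z) \<in> elems (besov N \<omega>)" for n
      using cb[of N] unit_fun_in_besov by (auto simp: column_bound_def)
    then have \<Psi>Hol: "\<forall>n. \<Psi> n \<in> Hol"
      by (simp add: \<Psi>_def elems_besov)
    have bound: "(vnorm H (\<lambda>z. \<Sum>n\<in>A. \<Phi> n z * h n z))\<^sup>2 \<le> (c * \<kappa>)\<^sup>2 * (\<Sum>n\<in>A. (vnorm H (h n))\<^sup>2)"
      if h: "\<And>n. h n \<in> elems H" and A: "finite A" for h A
    proof -
      let ?f = "\<lambda>z. \<Sum>n\<in>A. \<Phi> n z * h n z"
      have "\<Psi> n z * h n z = \<Phi> n z * h n z" for n z
        using h HHol Hol_outside[of "h n" z] by (auto simp: \<Psi>_def unit_fun_def)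
      then have \<Psi>\<Phi>: "(\<lambda>z. \<Sum>n\<in>A. \<Psi> n z * h n z) = ?f"
        by (simp only:)
      have 1: "(vnorm (besov N \<omega>) ?f)\<^sup>2 \<le> C * (K\<^sup>2 * (\<Sum>n\<in>A. (vnorm (besov N \<omega>) (h n))\<^sup>2))"
        using C(2)[OF \<Psi>Hol \<Psi>cb _ A, of h] h eq unfolding \<Psi>\<Phi> by simp
      have f: "?f \<in> elems H"
        using \<Phi> h by (intro finite_sum) (auto simp: MC_def Mult_def)
      have "a\<^sup>2 * (vnorm H ?f)\<^sup>2 \<le> (vnorm (besov N \<omega>) ?f)\<^sup>2"
        unfolding power_mult_distrib[symmetric]
        using le[OF f] vnorm_nonneg[OF f] ab by (intro power_mono) auto
      also note 1
      also have "(\<Sum>n\<in>A. (vnorm (besov N \<omega>) (h n))\<^sup>2) \<le> (\<Sum>n\<in>A. (b * vnorm H (h n))\<^sup>2)"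
        using le[OF h] by (intro sum_mono power_mono vnorm_besov_nonneg) auto
      also have "\<dots> = b\<^sup>2 * (\<Sum>n\<in>A. (vnorm H (h n))\<^sup>2)"
        by (simp add: power_mult_distrib sum_distrib_left)
      finally have "a\<^sup>2 * (vnorm H ?f)\<^sup>2 \<le> C * (K\<^sup>2 * (b\<^sup>2 * (\<Sum>n\<in>A. (vnorm H (h n))\<^sup>2)))"
        using C(1) by (simp add: mult_left_mono)
      then show ?thesis
        using ab C(1) by (simp add: c_def K_def power_mult_distrib power_divide field_simps)
    qed
    have out: "\<And>f z. f \<in> elems H \<Longrightarrow> z \<notin> Bd \<Longrightarrow> f z = 0"
      using HHol Hol_outside by blast
    have mult: "\<And>n. \<Phi> n \<in> Mult H" using \<Phi> by (simp add: MC_def)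
    have nn: "0 \<le> c * \<kappa>" using c \<kappa> by simp
    have "\<Phi> \<in> MR H" by (rule finite_row_bound_imp_MR[OF _ mult nn]) (fact out bound)+
    moreover have "row_norm H \<Phi> \<le> 2 * (c * \<kappa>)"
      by (rule finite_row_bound_imp_row_norm[OF _ mult nn]) (fact out bound)+
    ultimately show ?thesis by (simp add: \<kappa>_def)
  qed
  show ?thesis
  \<comment> \<open>Adding 1 makes the constant strictly positive even if \<open>c\<close> is
    0.\<close>
  proof (intro conjI exI[of _ "2 * c + 1"] ballI)
    show "MC H \<subseteq> MR H" using main by blast
    show "row_norm H \<Phi> \<le> (2 * c + 1) * column_norm H \<Phi>" if "\<Phi> \<in> MC H" for \<Phi>
      using main[OF that] column_norm_nonneg[OF that] by (simp add: distrib_right)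
  qed (use c in simp)
qed

end
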